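(* The complete set of eigenpolynomials of the multivariate Meixner system is, for $\boldsymbol m=(m_0,m_1,\ldots,m_{n-1})\in\mathcal X=\mathbb N_0^n$, $$\mathcal P_{M\boldsymbol m}(\boldsymbol x;\boldsymbol a,\beta)=\prod_{i=1}^{n-1}\mathcal P^{(i)}_{Mm_i}\Bigl(x_i,\;x_{>i}-\sum_{j=i+1}^{n-1}m_j;\;a_i,\;a_{>i}\Bigr)\;M_{m_0}\Bigl(|x|-\sum_{j=1}^{n-1}m_j;\;|a|,\;\beta+\sum_{j=1}^{n-1}m_j\Bigr),$$ that is, explicitly, $$\mathcal P_{M\boldsymbol m}=\prod_{i=1}^{n-1}\Biggl(\sum_{k=0}^{m_i}(-1)^k\binom{m_i}{k}\Bigl(\frac{a_{>i}}{a_i}\Bigr)^k(-x_i)_k\Bigl(-x_{>i}+\sum_{j=i+1}^{n-1}m_j\Bigr)_{m_i-k}\Biggr)\times{}_2F_1\left(\begin{matrix}-m_0,\ -|x|+\sum_{j=1}^{n-1}m_j\\ \beta+\sum_{j=1}^{n-1}m_j\end{matrix}\Bigm|\frac{|a|-1}{|a|}\right).$$ With $|m|=m_0+m_1+\cdots+m_{n-1}$, they satisfy $$\widetilde{\mathcal H}_{MT}\mathcal P_{M\boldsymbol m}=|m|(1-|a|)\mathcal P_{M\boldsymbol m},$$ $$\widetilde{\mathcal H}_{Mi}\mathcal P_{M\boldsymbol m}=-|m|\Bigl(\sum_{j=i}^na_j\Bigr)\mathcal P_{M\boldsymbol m},\qquad i=1,\ldots,n-1,$$ $$(\mathcal P_{M\boldsymbol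 m},\mathcal P_{M\boldsymbol m'})=0,\qquad\boldsymbol m\neq\boldsymbol m',\quad \boldsymbol m,\boldsymbol m'\in\mathcal X.$$
   Context: Fix an integer $n\ge2$, a real $\beta>0$ and real parameters $a_1,\ldots,a_n>0$ with $|a|=\sum_{i=1}^na_i<1$; $\boldsymbol a=(a_1,\ldots,a_n)$. Here $\mathcal X=\mathbb N_0^n$. For $\boldsymbol x=(x_1,\ldots,x_n)$ let $|x|=\sum_{i=1}^nx_i$, and for $1\le i\le n-1$ let $x_{>i}=x_{i+1}+\cdots+x_n$, $a_{>i}=a_{i+1}+\cdots+a_n$. $(c)_k=c(c+1)\cdots(c+k-1)$, $(c)_0=1$. Empty sums are $0$. "Complete set" means that the eigenpolynomials form a basis of the space of real polynomials in $x_1,\ldots,x_n$. The multivariate Meixner system is given by the following difference operators acting on polynomials ($\boldsymbol e_j$ the $j$-th unit vector): $\widetilde{\mathcal H}_{MT}=\widetilde{\mathcal H}_{M0}+\widetilde{\mathcal H}_{M1}$ with $$\widetilde{\mathcal H}_{M0}p(\boldsymbol x)=\sum_{j=1}^n\Bigl((\beta+|x|)a_j\bigl(p(\boldsymbol x)-p(\boldsymbol x+\boldsymbol e_j)\bigr)+x_j\bigl(p(\boldsymbol x)-p(\boldsymbol x-\boldsymbol e_j)\bigr)\Bigr),$$ $$\widetilde{\mathcal H}_{Mi}p(\boldsymbol x)=-\sum_{\substack{i\le j,k\le n\\ j\ne k}}x_ja_k\bigl(p(\boldsymbol x)-p(\boldsymbol x-\boldsymbol e_j+\boldsymbol e_k)\bigr),\quad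 i=1,\ldots,n-1.$$ Weight and inner product: $$W_M(\boldsymbol x)=\frac{(\beta)_{|x|}\prod_{i=1}^na_i^{x_i}}{x_1!\cdots x_n!}(1-|a|)^\beta,\qquad (p,q)=\sum_{\boldsymbol x\in\mathbb N_0^n}p(\boldsymbol x)q(\boldsymbol x)W_M(\boldsymbol x).$$ Single variable Meixner polynomial: $M_m(x;c,\beta)={}_2F_1\left(\begin{matrix}-m,\ -x\\ \beta\end{matrix}\Bigm|1-c^{-1}\right)=\sum_{k=0}^m\frac{(-m)_k(-x)_k}{(\beta)_k\,k!}(1-c^{-1})^k$. Type two polynomials (the superscript $(i)$ is only a label): $\mathcal P^{(i)}_{Mm}(u,v;\alpha,\gamma)=\sum_{k=0}^m(-1)^k\binom mk\bigl(\gamma/\alpha\bigr)^k(-u)_k(-v)_{m-k}$.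
   Formalization: The eigenvalue of H_Mi is corrected from -|m|(a_i+...+a_n) to -(m_i+...+m_{n-1})(a_i+...+a_n); the printed one fails for m=(1,0,...,0), where P_m is a nonzero function of |x| alone and H_Mi annihilates it. *)

theory Defs
  imports "HOL-Analysis.Analysis" "HOL-Library.Function_Algebras" "HOL-Library.FuncSet"
begin

text \<open>
  Real-valued functions form a real vector space under the pointwise operations, so that the
  library's \<open>span\<close> and \<open>independent\<close> apply to polynomial functions.
\<close>

instantiation "fun" :: (type, real_vector) real_vector
begin

definition scaleR_fun :: "real \<Rightarrow> ('a \<Rightarrow> 'b) \<Rightarrow> 'a \<Rightarrow> 'b" where
  "scaleR_fun c f = (\<lambda>x. c *\<^sub>R f x)"

instance
  by standard (auto simp: scaleR_fun_def plus_fun_def scaleR_add_right scaleR_add_left)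

end

text \<open>
  Conventions. A point \<open>(x\<^sub>1, \<dots>, x\<^sub>n)\<close> is a function on \<open>nat\<close> of which only the values at
  \<open>1, \<dots>, n\<close> are used; likewise for the parameters \<open>a\<close>. A multi-index \<open>m\<close> uses the values at
  \<open>0, \<dots>, n - 1\<close>. Polynomials are identified with the polynomial functions they induce on real
  points, and the difference operators act on such functions.
\<close>

definition poly_space :: "nat \<Rightarrow> ((nat \<Rightarrow> real) \<Rightarrow> real) set" where
  "poly_space n = span {(\<lambda>x. \<Prod>i = 1..n. x i ^ k i) | k :: nat \<Rightarrow> nat. True}"

text \<open>
  The two copies of \<open>\<nat>\<^sup>n\<close>: lattice points are indexed by \<open>1, \<dots>, n\<close>, multi-indices by
  \<open>0, \<dots>, n - 1\<close>. Extensionality makes each tuple occur exactly once.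
\<close>

definition lattice :: "nat \<Rightarrow> (nat \<Rightarrow> nat) set" where
  "lattice n = {1..n} \<rightarrow>\<^sub>E UNIV"

definition multi_indices :: "nat \<Rightarrow> (nat \<Rightarrow> nat) set" where
  "multi_indices n = {0..<n} \<rightarrow>\<^sub>E UNIV"

definition HM0 :: "nat \<Rightarrow> (nat \<Rightarrow> real) \<Rightarrow> real \<Rightarrow> ((nat \<Rightarrow> real) \<Rightarrow> real) \<Rightarrow> (nat \<Rightarrow> real) \<Rightarrow> real" where
  "HM0 n a \<beta> p x =
    (\<Sum>j = 1..n. (\<beta> + (\<Sum>i = 1..n. x i)) * a j * (p x - p (x(j := x j + 1)))
       + x j * (p x - p (x(j := x j - 1))))"

definition HM_sub :: "nat \<Rightarrow> (nat \<Rightarrow> real) \<Rightarrow> nat \<Rightarrow> ((nat \<Rightarrow> real) \<Rightarrow> real) \<Rightarrow> (nat \<Rightarrow> real) \<Rightarrow> real" where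
  "HM_sub n a i p x =
    - (\<Sum>(j, k) \<in> {(j, k). j \<in> {i..n} \<and> k \<in> {i..n} \<and> j \<noteq> k}.
        x j * a k * (p x - p (x(j := x j - 1, k := x k + 1))))"

definition HMT :: "nat \<Rightarrow> (nat \<Rightarrow> real) \<Rightarrow> real \<Rightarrow> ((nat \<Rightarrow> real) \<Rightarrow> real) \<Rightarrow> (nat \<Rightarrow> real) \<Rightarrow> real" where
  "HMT n a \<beta> p x = HM0 n a \<beta> p x + HM_sub n a 1 p x"

text \<open>
  The operators \<open>HM_sub n a i\<close> preserve \<open>x\<^sub>i + \<dots> + x\<^sub>n\<close> and do not move \<open>x\<^sub>1, \<dots>, x\<^bsub>i-1\<^esub>\<close>, so they
  annihilate every function of \<open>|x|\<close>. In particular they annihilate the eigenpolynomial with index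
  \<open>(m\<^sub>0, 0, \<dots>, 0)\<close>, which is why their eigenvalues involve \<open>m\<^sub>i + \<dots> + m\<^bsub>n-1\<^esub>\<close> and not the full
  degree \<open>|m| = m\<^sub>0 + \<dots> + m\<^bsub>n-1\<^esub>\<close>.
\<close>

lemma HM_sub_radial:
  assumes "1 \<le> i"
  shows "HM_sub n a i (\<lambda>x. f (\<Sum>l = 1..n. x l)) x = 0"
proof -
  have "(\<Sum>l = 1..n. (x(j := x j - 1, k := x k + 1)) l) = (\<Sum>l = 1..n. x l)"
    if "j \<in> {i..n}" "k \<in> {i..n}" "j \<noteq> k" for j k
  proof -
    have jk: "j \<in> {1..n}" "k \<in> {1..n} - {j}"
      using that assms by auto
    have split: "(\<Sum>l = 1..n. g l) = g j + (g k + (\<Sum>l \<in> {1..n} - {j} - {k}. g l))"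
      for g :: "nat \<Rightarrow> real"
      using sum.remove[OF finite_atLeastAtMost jk(1), of g]
        sum.remove[OF finite_Diff[OF finite_atLeastAtMost] jk(2), of g] by linarith
    have "(\<Sum>l \<in> {1..n} - {j} - {k}. (x(j := x j - 1, k := x k + 1)) l)
        = (\<Sum>l \<in> {1..n} - {j} - {k}. x l)"
      by (rule sum.cong) auto
    then show ?thesis
      using that(3) split[of x] split[of "x(j := x j - 1, k := x k + 1)"] by simp
  qed
  then show ?thesis
    unfolding HM_sub_def by (auto intro!: sum.neutral)
qed

definition WM :: "nat \<Rightarrow> (nat \<Rightarrow> real) \<Rightarrow> real \<Rightarrow> (nat \<Rightarrow> nat) \<Rightarrow> real" where
  "WM n a \<beta> x =
    pochhammer \<beta> (\<Sum>i = 1..n. x i) * (\<Prod>i = 1..n. a i ^ x i) / (\<Prod>i = 1..n. fact (x i))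
      * (1 - (\<Sum>i = 1..n. a i)) powr \<beta>"

definition ip_summand ::
  "nat \<Rightarrow> (nat \<Rightarrow> real) \<Rightarrow> real \<Rightarrow> ((nat \<Rightarrow> real) \<Rightarrow> real) \<Rightarrow> ((nat \<Rightarrow> real) \<Rightarrow> real) \<Rightarrow> (nat \<Rightarrow> nat) \<Rightarrow> real"
  where
  "ip_summand n a \<beta> p q x = p (\<lambda>i. real (x i)) * q (\<lambda>i. real (x i)) * WM n a \<beta> x"

text \<open>\<open>infsum\<close> is \<open>0\<close> for families that are not summable, so a statement about the inner product
  must also assert \<open>summable_on\<close>.\<close>

definition ip :: "nat \<Rightarrow> (nat \<Rightarrow> real) \<Rightarrow> real \<Rightarrow> ((nat \<Rightarrow> real) \<Rightarrow> real) \<Rightarrow> ((nat \<Rightarrow> real) \<Rightarrow> real) \<Rightarrow> real"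
  where
  "ip n a \<beta> p q = (\<Sum>\<^sub>\<infinity>x\<in>lattice n. ip_summand n a \<beta> p q x)"

definition hyp2F1 :: "real \<Rightarrow> real \<Rightarrow> real \<Rightarrow> real \<Rightarrow> real" where
  "hyp2F1 a b c z = (\<Sum>k. pochhammer a k * pochhammer b k / (pochhammer c k * fact k) * z ^ k)"

lemma hyp2F1_terminating:
  "hyp2F1 (- real m) b c z =
    (\<Sum>k\<le>m. pochhammer (- real m) k * pochhammer b k / (pochhammer c k * fact k) * z ^ k)"
  unfolding hyp2F1_def
  by (rule suminf_finite) (auto simp: pochhammer_of_nat_eq_0_iff)

definition meixner :: "nat \<Rightarrow> real \<Rightarrow> real \<Rightarrow> real \<Rightarrow> real" where
  "meixner m x c \<beta> = hyp2F1 (- real m) (- x) \<beta> (1 - inverse c)"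

definition type_two :: "nat \<Rightarrow> real \<Rightarrow> real \<Rightarrow> real \<Rightarrow> real \<Rightarrow> real" where
  "type_two m u v \<alpha> \<gamma> =
    (\<Sum>k\<le>m. (-1) ^ k * real (m choose k) * (\<gamma> / \<alpha>) ^ k * pochhammer (- u) k * pochhammer (- v) (m - k))"

definition PM :: "nat \<Rightarrow> (nat \<Rightarrow> real) \<Rightarrow> real \<Rightarrow> (nat \<Rightarrow> nat) \<Rightarrow> (nat \<Rightarrow> real) \<Rightarrow> real" where
  "PM n a \<beta> m x =
    (\<Prod>i = 1..n - 1. type_two (m i) (x i) ((\<Sum>j = i + 1..n. x j) - real (\<Sum>j = i + 1..n - 1. m j))
        (a i) (\<Sum>j = i + 1..n. a j))
    * meixner (m 0) ((\<Sum>i = 1..n. x i) - real (\<Sum>j = 1..n - 1. m j))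
        (\<Sum>i = 1..n. a i) (\<beta> + real (\<Sum>j = 1..n - 1. m j))"

end

theory Submission
  imports Defs
begin

text \<open>
  Put \<open>|x| = x\<^sub>1 + \<dots> + x\<^sub>n\<close> and let \<open>M\<^sub>i = m\<^sub>i + \<dots> + m\<^bsub>n-1\<^esub>\<close>. The argument rests on two first-order difference
  operators in the variables \<open>x\<^sub>i, \<dots>, x\<^sub>n\<close>,
  \<open>lower f(x) = \<Sum> x\<^sub>j f(x - e\<^sub>j)\<close> and \<open>raise f(x) = \<Sum> a\<^sub>k f(x + e\<^sub>k)\<close> with \<open>j, k\<close> running over \<open>i, \<dots>, n\<close>.
  All operators of the system are built from them: the \<open>i\<close>-th suboperator is the product of \<open>lower\<close> and
  \<open>raise\<close> minus multiplication by \<open>(x\<^sub>i + \<dots> + x\<^sub>n) (a\<^sub>i + \<dots> + a\<^sub>n)\<close>, and \<open>HM0\<close> is the combination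
  \<open>(\<beta> + |x|) (|a| - raise) + (|x| - lower)\<close> for \<open>i = 1\<close>.

  The product of the type two factors with labels \<open>\<ge> i\<close> is multiplied by \<open>x\<^sub>i + \<dots> + x\<^sub>n - M\<^sub>i\<close> under \<open>lower\<close>
  and by \<open>a\<^sub>i + \<dots> + a\<^sub>n\<close> under \<open>raise\<close> (\<open>ladder_eigen_type_two_prod\<close>). This is an induction that adds one
  factor at a time, and the step consists of one contiguity relation for each operator
  (\<open>type_two_lower\<close>, \<open>type_two_raise\<close>). The eigenvalue equation of the \<open>i\<close>-th suboperator follows at
  once, because the remaining factors of the eigenpolynomial depend only on quantities which the
  suboperator leaves unchanged (\<open>HM_sub_PM\<close>). In \<open>HM0\<close> the type two product factors out, and what is left
  acts on the Meixner factor alone as the classical Meixner difference operator with \<open>\<beta>\<close> and \<open>|x|\<close>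
  replaced by \<open>\<beta> + M\<^sub>1\<close> and \<open>|x| - M\<^sub>1\<close> (\<open>HM0_PM\<close>).

  Orthogonality: the weight \<open>W\<close> satisfies
  \<open>(x\<^sub>j + 1) W(x + e\<^sub>j) = (\<beta> + |x|) a\<^sub>j W(x)\<close>, so moving the summation variable by \<open>e\<^sub>j\<close> turns
  multiplication by \<open>x\<^sub>j\<close> into a shift (\<open>wsum_shift\<close>), and \<open>HM0\<close> and the suboperators are symmetric. Their
  joint eigenvalues determine \<open>m\<^sub>0\<close> and all \<open>M\<^sub>i\<close>, hence \<open>m\<close>, so different eigenpolynomials are orthogonal.
  The sums converge because the weight sums to a negative multinomial series, which still converges
  when every \<open>a\<^sub>i\<close> is enlarged by a factor slightly above \<open>1\<close>; that factor absorbs any polynomial.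

  Completeness: the eigenpolynomial of \<open>m\<close> does not vanish at the lattice point
  \<open>(m\<^sub>1, \<dots>, m\<^bsub>n-1\<^esub>, 0)\<close>, so it has positive norm, and orthogonality makes the family injective and linearly
  independent. Since the eigenpolynomial of \<open>m\<close> has degree at most \<open>|m|\<close>, there are as many
  eigenpolynomials with \<open>|m| \<le> d\<close> as monomials of degree \<open>\<le> d\<close>, and counting dimensions shows that they span
  all polynomials of degree \<open>\<le> d\<close>.
\<close>

section \<open>Contiguity relations of the type two polynomials and the Meixner difference equation\<close>

lemma pochhammer_shift_down:
  fixes u :: real
  shows "u * pochhammer (- (u - 1)) k = (u - real k) * pochhammer (- u) k"
proof -
  have "- u * pochhammer (- u + 1) k = pochhammer (- u) k * (- u + real k)"
    by (metis pochhammer_Suc pochhammer_rec)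
  then show ?thesis
    by (simp add: algebra_simps)
qed

lemma pochhammer_shift_up:
  fixes u :: real
  shows "pochhammer (- (u + 1)) k - pochhammer (- u) k = - real k * pochhammer (- u) (k - 1)"
proof (cases k)
  case (Suc l)
  have "pochhammer (- (u + 1)) (Suc l) = - (u + 1) * pochhammer (- u) l"
    using pochhammer_rec[of "- (u + 1)" l] by simp
  then show ?thesis
    by (simp add: Suc pochhammer_Suc algebra_simps)
qed simp

text \<open>
  Every summand \<open>(-u)\<^sub>k (-v)\<^bsub>m-k\<^esub>\<close> is separately an eigenfunction, because \<open>u (-u + 1)\<^sub>k = (u - k) (-u)\<^sub>k\<close>
  and the defects \<open>k\<close> and \<open>m - k\<close> always add up to \<open>m\<close>.
\<close>

lemma type_two_lower:
  "u * type_two m (u - 1) v \<alpha> \<gamma> + v * type_two m u (v - 1) \<alpha> \<gamma>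
    = (u + v - real m) * type_two m u v \<alpha> \<gamma>"
proof -
  define c where "c k = (-1) ^ k * real (m choose k) * (\<gamma> / \<alpha>) ^ k" for k
  have "c k * (u * pochhammer (- (u - 1)) k) * pochhammer (- v) (m - k)
      + c k * pochhammer (- u) k * (v * pochhammer (- (v - 1)) (m - k))
      = (u + v - real m) * (c k * pochhammer (- u) k * pochhammer (- v) (m - k))"
    if "k \<le> m" for k
    unfolding pochhammer_shift_down using that by (simp add: of_nat_diff algebra_simps)
  then have "(\<Sum>k\<le>m. c k * (u * pochhammer (- (u - 1)) k) * pochhammer (- v) (m - k)
      + c k * pochhammer (- u) k * (v * pochhammer (- (v - 1)) (m - k)))
      = (\<Sum>k\<le>m. (u + v - real m) * (c k * pochhammer (- u) k * pochhammer (- v) (m - k)))"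
    by (intro sum.cong) auto
  then show ?thesis
    unfolding type_two_def c_def[symmetric] sum_distrib_left sum.distrib
    by (simp add: mult_ac)
qed

text \<open>
  This relation is what forces the coefficients of the type two polynomials: \<open>\<alpha>\<close> times the forward
  difference in \<open>u\<close> plus \<open>\<gamma>\<close> times that in \<open>v\<close> has to vanish.
\<close>

lemma type_two_raise:
  assumes "\<alpha> \<noteq> 0"
  shows "\<alpha> * type_two m (u + 1) v \<alpha> \<gamma> + \<gamma> * type_two m u (v + 1) \<alpha> \<gamma>
    = (\<alpha> + \<gamma>) * type_two m u v \<alpha> \<gamma>"
proof -
  define c where "c k = (-1) ^ k * real (m choose k) * (\<gamma> / \<alpha>) ^ k" for k
  define \<Delta>u where "\<Delta>u k = \<alpha> * (c k * (pochhammer (- (u + 1)) k - pochhammer (- u) k)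
      * pochhammer (- v) (m - k))" for k
  define \<Delta>v where "\<Delta>v k = \<gamma> * (c k * pochhammer (- u) k
      * (pochhammer (- (v + 1)) (m - k) - pochhammer (- v) (m - k)))" for k
  have absorb: "real (Suc k) * real (m choose Suc k) = real (m - k) * real (m choose k)" for k
    by (metis binomial_absorb_comp binomial_absorption of_nat_mult)
  \<comment> \<open>Going from \<open>k\<close> to \<open>k + 1\<close> multiplies the coefficient by \<open>- (\<gamma> / \<alpha>) (m - k) / (k + 1)\<close>.\<close>
  have coeff: "\<alpha> * (real (Suc k) * c (Suc k)) = - (\<gamma> * (real (m - k) * c k))" for k
  proof -
    have "\<alpha> * (real (Suc k) * c (Suc k))
        = - ((-1) ^ k * (\<gamma> / \<alpha>) ^ k * (\<alpha> * (\<gamma> / \<alpha>)) * (real (Suc k) * real (m choose Suc k)))"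
      by (simp add: c_def mult_ac)
    also have "\<dots> = - (\<gamma> * (real (m - k) * c k))"
      unfolding absorb using assms by (simp add: c_def mult_ac)
    finally show ?thesis .
  qed
  \<comment> \<open>The term with index \<open>k + 1\<close> of the \<open>u\<close>-difference cancels that with index \<open>k\<close> of the
    \<open>v\<close>-difference; the two unmatched end terms vanish.\<close>
  have cancel: "\<Delta>u (Suc k) + \<Delta>v k = 0" for k
  proof -
    have "\<Delta>u (Suc k) + \<Delta>v k = - (\<alpha> * (real (Suc k) * c (Suc k)) + \<gamma> * (real (m - k) * c k))
        * (pochhammer (- u) k * pochhammer (- v) (m - Suc k))"
      unfolding \<Delta>u_def \<Delta>v_def pochhammer_shift_up by (simp add: algebra_simps)
    then show ?thesis
      unfolding coeff by simp
  qed
  have "(\<Sum>k\<le>m. \<Delta>u k) = \<Delta>u 0 + (\<Sum>k<m. \<Delta>u (Suc k))"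
    by (rule sum.atMost_shift)
  moreover have "(\<Sum>k\<le>m. \<Delta>v k) = (\<Sum>k<m. \<Delta>v k) + \<Delta>v m"
    by (simp flip: lessThan_Suc_atMost)
  ultimately have "(\<Sum>k\<le>m. \<Delta>u k) + (\<Sum>k\<le>m. \<Delta>v k)
      = \<Delta>u 0 + (\<Sum>k<m. \<Delta>u (Suc k) + \<Delta>v k) + \<Delta>v m"
    by (simp add: sum.distrib)
  also have "\<dots> = 0"
    unfolding cancel by (simp add: \<Delta>u_def \<Delta>v_def)
  finally have "(\<Sum>k\<le>m. \<Delta>u k) + (\<Sum>k\<le>m. \<Delta>v k) = 0" .
  moreover have "(\<Sum>k\<le>m. \<Delta>u k) = \<alpha> * (type_two m (u + 1) v \<alpha> \<gamma> - type_two m u v \<alpha> \<gamma>)"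
    unfolding type_two_def c_def[symmetric] \<Delta>u_def
    by (simp add: sum_distrib_left algebra_simps flip: sum_subtractf)
  moreover have "(\<Sum>k\<le>m. \<Delta>v k) = \<gamma> * (type_two m u (v + 1) \<alpha> \<gamma> - type_two m u v \<alpha> \<gamma>)"
    unfolding type_two_def c_def[symmetric] \<Delta>v_def
    by (simp add: sum_distrib_left algebra_simps flip: sum_subtractf)
  ultimately show ?thesis
    by (simp add: algebra_simps)
qed

lemma meixner_eq_sum:
  "meixner m t c \<beta> = (\<Sum>k\<le>m. pochhammer (- real m) k / (pochhammer \<beta> k * fact k)
     * (1 - inverse c) ^ k * pochhammer (- t) k)"
  unfolding meixner_def hyp2F1_terminating by (rule sum.cong) auto

text \<open>
  In the basis \<open>(-t)\<^sub>k\<close> the backward part is diagonal and the forward part is bidiagonal, so the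
  equation reduces to the two-term recurrence of the hypergeometric coefficients; after subtracting the
  eigenvalue, the sum telescopes.
\<close>

lemma meixner_difference_equation:
  assumes "c \<noteq> 0" "\<beta> > 0"
  shows "c * (\<beta> + t) * (meixner m t c \<beta> - meixner m (t + 1) c \<beta>)
    + t * (meixner m t c \<beta> - meixner m (t - 1) c \<beta>) = real m * (1 - c) * meixner m t c \<beta>"
proof -
  define A where "A k = pochhammer (- real m) k / (pochhammer \<beta> k * fact k) * (1 - inverse c) ^ k" for k
  define p where "p k = pochhammer (- t) k" for k
  \<comment> \<open>The part of the forward difference at index \<open>k\<close> that lowers the index. It carries the factor
    \<open>k\<close>, so the truncated value of \<open>k - 1\<close> at \<open>k = 0\<close> is harmless.\<close>
  define B where "B k = c * real k * (\<beta> + real k - 1) * A k * p (k - 1)" for k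
  have M: "meixner m s c \<beta> = (\<Sum>k\<le>m. A k * pochhammer (- s) k)" for s
    unfolding meixner_eq_sum A_def ..
  have recurrence: "c * (real (Suc k) * ((\<beta> + real k) * A (Suc k))) = (real m - real k) * (1 - c) * A k" for k
  proof -
    have nz: "\<beta> + real k \<noteq> 0" "pochhammer \<beta> k \<noteq> 0" "real (Suc k) \<noteq> 0"
      using assms(2) pochhammer_pos[of \<beta> k] by auto
    define w where "w = 1 - inverse c"
    define X where "X = pochhammer (- real m) k * w ^ k"
    have "A (Suc k) = X * ((- real m + real k) * w)
        / ((pochhammer \<beta> k * (\<beta> + real k)) * (real (Suc k) * fact k))"
      unfolding A_def X_def w_def pochhammer_Suc fact_Suc power_Suc2 of_nat_mult of_nat_fact
      by (simp add: mult_ac)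
    then have "real (Suc k) * ((\<beta> + real k) * A (Suc k))
        = X / (pochhammer \<beta> k * fact k) * ((- real m + real k) * w)"
      using nz by (simp add: divide_simps mult_ac del: of_nat_Suc)
    moreover have "A k = X / (pochhammer \<beta> k * fact k)"
      by (simp add: A_def X_def w_def)
    moreover have "c * w = c - 1"
      using assms(1) by (simp add: w_def field_simps)
    ultimately have "c * (real (Suc k) * ((\<beta> + real k) * A (Suc k)))
        = A k * ((- real m + real k) * (c - 1))"
      by (metis mult.left_commute)
    then show ?thesis
      by (simp add: algebra_simps)
  qed
  have up: "(\<beta> + t) * (p k - pochhammer (- (t + 1)) k)
      = real k * ((\<beta> + real k - 1) * p (k - 1) - p k)" for k
  proof (cases k)
    case 0
    then show ?thesis by (simp add: p_def)
  next
    case (Suc l)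
    have "p k - pochhammer (- (t + 1)) k = real k * p l"
      using pochhammer_shift_up[of t k] by (simp add: p_def Suc algebra_simps)
    then have "(\<beta> + t) * (p k - pochhammer (- (t + 1)) k) = (\<beta> + t) * (real k * p l)"
      by simp
    also have "\<dots> = real k * ((\<beta> + real k - 1) * p (k - 1) - p k)"
      by (simp add: p_def Suc pochhammer_Suc algebra_simps)
    finally show ?thesis .
  qed
  have down: "t * (p k - pochhammer (- (t - 1)) k) = real k * p k" for k
    using pochhammer_shift_down[of t k] by (simp add: p_def algebra_simps)
  have termwise: "c * (\<beta> + t) * (A k * p k - A k * pochhammer (- (t + 1)) k)
      + t * (A k * p k - A k * pochhammer (- (t - 1)) k) - real m * (1 - c) * (A k * p k)
      = B k - B (Suc k)" for k
  proof -
    have "B (Suc k) = (real m - real k) * (1 - c) * A k * p k"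
      unfolding B_def recurrence[symmetric] by (simp add: mult_ac)
    moreover have "c * (\<beta> + t) * (A k * p k - A k * pochhammer (- (t + 1)) k)
        = c * A k * (real k * ((\<beta> + real k - 1) * p (k - 1) - p k))"
      unfolding up[symmetric] by (simp add: algebra_simps)
    moreover have "t * (A k * p k - A k * pochhammer (- (t - 1)) k) = A k * (real k * p k)"
      unfolding down[symmetric] by (simp add: algebra_simps)
    ultimately show ?thesis
      by (simp add: B_def algebra_simps)
  qed
  have "A (Suc m) = 0"
    by (simp add: A_def pochhammer_of_nat_eq_0_lemma)
  have "c * (\<beta> + t) * (meixner m t c \<beta> - meixner m (t + 1) c \<beta>)
    + t * (meixner m t c \<beta> - meixner m (t - 1) c \<beta>) - real m * (1 - c) * meixner m t c \<beta>
     = (\<Sum>k\<le>m. B k - B (Suc k))"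
    unfolding termwise[symmetric] M p_def
    by (simp only: sum_distrib_left sum_subtractf sum.distrib right_diff_distrib)
  also have "\<dots> = B 0 - B (Suc m)"
    by (rule sum_telescope)
  also have "\<dots> = 0"
    by (simp add: B_def \<open>A (Suc m) = 0\<close>)
  finally show ?thesis by simp
qed

section \<open>Ladder operators and the eigenvalue equations\<close>

text \<open>
  The first-order operators from which all operators of the system are composed: \<open>HM_sub\<close> with label \<open>i\<close>
  uses those starting at \<open>i\<close>, and \<open>HM0\<close> uses those starting at \<open>1\<close>.
\<close>

definition lower :: "nat \<Rightarrow> nat \<Rightarrow> ((nat \<Rightarrow> real) \<Rightarrow> real) \<Rightarrow> (nat \<Rightarrow> real) \<Rightarrow> real" where
  "lower n i f x = (\<Sum>j = i..n. x j * f (x(j := x j - 1)))"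

definition raise ::
  "nat \<Rightarrow> (nat \<Rightarrow> real) \<Rightarrow> nat \<Rightarrow> ((nat \<Rightarrow> real) \<Rightarrow> real) \<Rightarrow> (nat \<Rightarrow> real) \<Rightarrow> real" where
  "raise n a i f x = (\<Sum>k = i..n. a k * f (x(k := x k + 1)))"

text \<open>
  The joint eigenvalue condition that lets a factor split off from the operators of the system. The number \<open>d\<close> is the degree in \<open>x\<^sub>i, \<dots>, x\<^sub>n\<close> in the cases of interest.
\<close>

definition ladder_eigen ::
  "nat \<Rightarrow> (nat \<Rightarrow> real) \<Rightarrow> nat \<Rightarrow> nat \<Rightarrow> ((nat \<Rightarrow> real) \<Rightarrow> real) \<Rightarrow> bool" where
  "ladder_eigen n a i d f \<longleftrightarrow>
    (\<forall>x. lower n i f x = ((\<Sum>j = i..n. x j) - real d) * f x \<and> raise n a i f x = (\<Sum>j = i..n. a j) * f x)"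

lemma sum_interval_upd:
  fixes x :: "nat \<Rightarrow> real"
  shows "(\<Sum>l = i..n. (x(j := y)) l) = (\<Sum>l = i..n. x l) + (if j \<in> {i..n} then y - x j else 0)"
proof (cases "j \<in> {i..n}")
  case True
  have "(\<Sum>l = i..n. (x(j := y)) l) = y + (\<Sum>l \<in> {i..n} - {j}. x l)"
    using sum.remove[OF finite_atLeastAtMost True, of "x(j := y)"] by simp
  then show ?thesis
    using True sum.remove[OF finite_atLeastAtMost True, of x] by simp
next
  case False
  then show ?thesis
    by (auto intro!: sum.cong)
qed

definition type_two_prod :: "nat \<Rightarrow> (nat \<Rightarrow> real) \<Rightarrow> (nat \<Rightarrow> nat) \<Rightarrow> nat \<Rightarrow> (nat \<Rightarrow> real) \<Rightarrow> real" where
  "type_two_prod n a m i x =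
    (\<Prod>l = i..n - 1. type_two (m l) (x l) ((\<Sum>j = l + 1..n. x j) - real (\<Sum>j = l + 1..n - 1. m j))
        (a l) (\<Sum>j = l + 1..n. a j))"

lemma type_two_prod_step:
  assumes "i < n"
  shows "type_two_prod n a m i x =
    type_two (m i) (x i) ((\<Sum>j = i + 1..n. x j) - real (\<Sum>j = i + 1..n - 1. m j))
        (a i) (\<Sum>j = i + 1..n. a j) * type_two_prod n a m (Suc i) x"
  unfolding type_two_prod_def using assms by (subst prod.atLeast_Suc_atMost) auto

lemma type_two_prod_upd_below:
  assumes "j < i"
  shows "type_two_prod n a m i (x(j := y)) = type_two_prod n a m i x"
  unfolding type_two_prod_def using assms by (intro prod.cong) (auto simp: sum_interval_upd)

text \<open>
  Downward induction on \<open>i\<close>. The new factor sees the old variables only through \<open>x\<^bsub>i+1\<^esub> + \<dots> + x\<^sub>n\<close>, which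
  every shift of the old variables moves by one, and the shift by \<open>m\<^bsub>i+1\<^esub> + \<dots> + m\<^bsub>n-1\<^esub>\<close> in its second
  argument makes the eigenvalue of the old product equal to that argument. Thus the contiguity
  relations of the new factor apply verbatim.
\<close>

lemma ladder_eigen_type_two_prod:
  assumes "i \<le> n" "1 \<le> n" "\<And>l. l \<in> {i..n} \<Longrightarrow> a l \<noteq> 0"
  shows "ladder_eigen n a i (\<Sum>j = i..n - 1. m j) (type_two_prod n a m i)"
  using assms(1,3)
proof (induction i rule: inc_induct)
  case base
  then show ?case
    using assms(2) by (auto simp: ladder_eigen_def lower_def raise_def type_two_prod_def)
next
  case (step i)
  define d where "d = (\<Sum>j = Suc i..n - 1. m j)"
  define \<gamma> where "\<gamma> = (\<Sum>j = Suc i..n. a j)"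
  define s where "s x = (\<Sum>j = Suc i..n. x j)" for x :: "nat \<Rightarrow> real"
  define q where "q u v = type_two (m i) u v (a i) \<gamma>" for u v
  let ?Q = "type_two_prod n a m (Suc i)"
  have IH: "lower n (Suc i) ?Q x = (s x - real d) * ?Q x" "raise n a (Suc i) ?Q x = \<gamma> * ?Q x" for x
    using step by (simp_all add: ladder_eigen_def d_def s_def \<gamma>_def)
  have eq: "type_two_prod n a m i x = q (x i) (s x - real d) * ?Q x" for x
    using step.hyps by (simp add: type_two_prod_step q_def d_def s_def \<gamma>_def)
  have head: "(\<Sum>j = i..n. g j) = g i + (\<Sum>j = Suc i..n. g j)" for g :: "nat \<Rightarrow> real"
    using step.hyps by (simp add: sum.atLeast_Suc_atMost)
  have degree: "(\<Sum>j = i..n - 1. m j) = m i + d"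
    using step.hyps by (simp add: d_def sum.atLeast_Suc_atMost)
  have upd_i: "type_two_prod n a m i (x(i := y)) = q y (s x - real d) * ?Q x" for x y
    by (simp add: eq type_two_prod_upd_below s_def sum_interval_upd)
  have upd_j: "type_two_prod n a m i (x(j := x j + c)) = q (x i) (s x - real d + c) * ?Q (x(j := x j + c))"
    if "j \<in> {Suc i..n}" for x j c
    using that by (simp add: eq s_def sum_interval_upd add_diff_eq diff_add_eq fun_upd_other del: fun_upd_apply)
  have upd_j': "type_two_prod n a m i (x(j := x j - 1)) = q (x i) (s x - real d - 1) * ?Q (x(j := x j - 1))"
    if "j \<in> {Suc i..n}" for x j
    using upd_j[OF that, of x "- 1"] by simp
  have "lower n i (type_two_prod n a m i) x
      = ((\<Sum>j = i..n. x j) - real (m i + d)) * type_two_prod n a m i x" for x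
  proof -
    have "lower n i (type_two_prod n a m i) x
        = x i * (q (x i - 1) (s x - real d) * ?Q x) + q (x i) (s x - real d - 1) * lower n (Suc i) ?Q x"
      unfolding lower_def head upd_i by (simp add: upd_j' sum_distrib_left mult_ac)
    also have "\<dots> = (x i * q (x i - 1) (s x - real d)
        + (s x - real d) * q (x i) (s x - real d - 1)) * ?Q x"
      by (simp add: IH algebra_simps)
    finally show ?thesis
      unfolding q_def type_two_lower head s_def[symmetric] eq by (simp add: algebra_simps)
  qed
  moreover have "raise n a i (type_two_prod n a m i) x
      = (\<Sum>j = i..n. a j) * type_two_prod n a m i x" for x
  proof -
    have "raise n a i (type_two_prod n a m i) x
        = a i * (q (x i + 1) (s x - real d) * ?Q x) + q (x i) (s x - real d + 1) * raise n a (Suc i) ?Q x"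
      unfolding raise_def head upd_i by (simp add: upd_j sum_distrib_left mult_ac)
    also have "\<dots> = (a i * q (x i + 1) (s x - real d)
        + \<gamma> * q (x i) (s x - real d + 1)) * ?Q x"
      by (simp add: IH algebra_simps)
    finally show ?thesis
      unfolding q_def head \<gamma>_def[symmetric] eq
      using step.prems step.hyps by (simp add: type_two_raise)
  qed
  ultimately show ?case
    unfolding ladder_eigen_def degree by blast
qed

text \<open>
  In the product of the two operators the diagonal terms \<open>j = k\<close> return to \<open>x\<close>; they are exactly what
  the off-diagonal sum omits.
\<close>

lemma HM_sub_eq_lower_raise:
  "HM_sub n a i f x = lower n i (raise n a i f) x - (\<Sum>j = i..n. x j) * (\<Sum>k = i..n. a k) * f x"
proof -
  define h where "h j k = x j * (a k * f ((x(j := x j - 1))(k := (x(j := x j - 1)) k + 1)))" for j k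
  have lr: "lower n i (raise n a i f) x = (\<Sum>j = i..n. \<Sum>k = i..n. h j k)"
    by (simp add: lower_def raise_def h_def sum_distrib_left)
  have diag: "h j j = x j * a j * f x" for j
    by (simp add: h_def)
  have off: "h j k = x j * a k * f (x(j := x j - 1, k := x k + 1))" if "j \<noteq> k" for j k
    using that by (simp add: h_def)
  have "(\<Sum>(j, k) \<in> {(j, k). j \<in> {i..n} \<and> k \<in> {i..n} \<and> j \<noteq> k}.
        x j * a k * (f x - f (x(j := x j - 1, k := x k + 1))))
      = (\<Sum>(j, k) \<in> {i..n} \<times> {i..n}. x j * a k * f x - h j k)"
    by (intro sum.mono_neutral_cong_left) (auto simp: off diag algebra_simps)
  also have "\<dots> = (\<Sum>j = i..n. x j) * (\<Sum>k = i..n. a k) * f x - lower n i (raise n a i f) x"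
    unfolding lr
    by (simp add: sum_subtractf flip: sum.cartesian_product sum_distrib_left sum_distrib_right)
  finally show ?thesis
    by (simp add: HM_sub_def)
qed

lemma HM_sub_ladder_eigen:
  assumes "ladder_eigen n a i d f"
  shows "HM_sub n a i f x = - real d * (\<Sum>j = i..n. a j) * f x"
proof -
  have "raise n a i f = (\<lambda>y. (\<Sum>j = i..n. a j) * f y)"
    using assms by (auto simp: ladder_eigen_def)
  then have "lower n i (raise n a i f) x = (\<Sum>j = i..n. a j) * lower n i f x"
    unfolding lower_def sum_distrib_left[of "\<Sum>j = i..n. a j" _ "{i..n}"] by (simp add: mult_ac)
  also have "lower n i f x = ((\<Sum>j = i..n. x j) - real d) * f x"
    using assms by (simp add: ladder_eigen_def)
  finally show ?thesis
    unfolding HM_sub_eq_lower_raise by (simp add: algebra_simps)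
qed

lemma HM_sub_mult_invariant:
  assumes "\<And>j k. j \<in> {i..n} \<Longrightarrow> k \<in> {i..n} \<Longrightarrow> j \<noteq> k \<Longrightarrow> r (x(j := x j - 1, k := x k + 1)) = r x"
  shows "HM_sub n a i (\<lambda>y. r y * f y) x = r x * HM_sub n a i f x"
proof -
  have "(\<Sum>(j, k) \<in> {(j, k). j \<in> {i..n} \<and> k \<in> {i..n} \<and> j \<noteq> k}.
        x j * a k * (r x * f x - r (x(j := x j - 1, k := x k + 1)) * f (x(j := x j - 1, k := x k + 1))))
      = (\<Sum>(j, k) \<in> {(j, k). j \<in> {i..n} \<and> k \<in> {i..n} \<and> j \<noteq> k}.
        r x * (x j * a k * (f x - f (x(j := x j - 1, k := x k + 1)))))"
    by (intro sum.cong) (auto simp: assms right_diff_distrib simp del: fun_upd_apply)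
  then show ?thesis
    unfolding HM_sub_def by (simp add: sum_distrib_left case_prod_unfold)
qed

lemma PM_eq_type_two_prod:
  "PM n a \<beta> m x = type_two_prod n a m 1 x
    * meixner (m 0) ((\<Sum>i = 1..n. x i) - real (\<Sum>j = 1..n - 1. m j))
        (\<Sum>i = 1..n. a i) (\<beta> + real (\<Sum>j = 1..n - 1. m j))"
  by (simp add: PM_def type_two_prod_def)

text \<open>
  The type two factors with label below \<open>i\<close> and the Meixner factor depend on \<open>x\<^sub>i, \<dots>, x\<^sub>n\<close> only through the
  sum of these variables, which the hops \<open>x - e\<^sub>j + e\<^sub>k\<close> preserve, so they pass through the operator as constants.
\<close>

lemma HM_sub_PM:
  assumes "1 \<le> i" "i \<le> n" "\<And>l. l \<in> {i..n} \<Longrightarrow> a l \<noteq> 0"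
  shows "HM_sub n a i (PM n a \<beta> m) x = - real (\<Sum>j = i..n - 1. m j) * (\<Sum>j = i..n. a j) * PM n a \<beta> m x"
proof -
  \<comment> \<open>The factors of the eigenpolynomial that the hops leave unchanged.\<close>
  define r where "r y =
    (\<Prod>l = 1..<i. type_two (m l) (y l) ((\<Sum>j = l + 1..n. y j) - real (\<Sum>j = l + 1..n - 1. m j))
        (a l) (\<Sum>j = l + 1..n. a j))
    * meixner (m 0) ((\<Sum>j = 1..n. y j) - real (\<Sum>j = 1..n - 1. m j))
        (\<Sum>j = 1..n. a j) (\<beta> + real (\<Sum>j = 1..n - 1. m j))" for y
  have "{1..n - 1} = {1..<i} \<union> {i..n - 1}"
    using assms(1,2) by auto
  then have PM: "PM n a \<beta> m = (\<lambda>y. r y * type_two_prod n a m i y)"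
    by (simp add: fun_eq_iff PM_def r_def type_two_prod_def prod.union_disjoint mult_ac ivl_disj_int)
  have "r (x(j := x j - 1, k := x k + 1)) = r x" if "j \<in> {i..n}" "k \<in> {i..n}" "j \<noteq> k" for j k
  proof -
    have tails: "(\<Sum>l' = l..n. (x(j := x j - 1, k := x k + 1)) l') = (\<Sum>l' = l..n. x l')" if "l \<le> i" for l
      using that \<open>j \<in> _\<close> \<open>k \<in> _\<close> \<open>j \<noteq> k\<close>
      by (simp add: sum_interval_upd fun_upd_other del: fun_upd_apply)
    show ?thesis
      unfolding r_def using that assms(1) by (auto simp: tails fun_upd_other simp del: fun_upd_apply intro!: prod.cong)
  qed
  then have "HM_sub n a i (PM n a \<beta> m) x = r x * HM_sub n a i (type_two_prod n a m i) x"
    unfolding PM by (rule HM_sub_mult_invariant)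
  also have "\<dots> = - real (\<Sum>j = i..n - 1. m j) * (\<Sum>j = i..n. a j) * PM n a \<beta> m x"
    using HM_sub_ladder_eigen[OF ladder_eigen_type_two_prod[of i n a m]] assms
    by (simp add: PM)
  finally show ?thesis .
qed

text \<open>
  A factor depending on \<open>|x|\<close> alone is moved by one step under every shift, so an eigenfunction of
  both ladder operators splits off and leaves a one-variable difference operator in \<open>|x|\<close>.
\<close>

lemma HM0_ladder_eigen:
  assumes "ladder_eigen n a 1 d f"
  shows "HM0 n a \<beta> (\<lambda>y. f y * g (\<Sum>i = 1..n. y i)) x
    = (let s = \<Sum>i = 1..n. x i in
        f x * ((\<Sum>j = 1..n. a j) * (\<beta> + s) * (g s - g (s + 1)) + s * g s - (s - real d) * g (s - 1)))"
proof -
  define s where "s = (\<Sum>i = 1..n. x i)"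
  have "HM0 n a \<beta> (\<lambda>y. f y * g (\<Sum>i = 1..n. y i)) x
     = (\<Sum>j = 1..n. (\<beta> + s) * f x * g s * a j - (\<beta> + s) * g (s + 1) * (a j * f (x(j := x j + 1)))
         + (f x * g s * x j - g (s - 1) * (x j * f (x(j := x j - 1)))))"
    unfolding HM0_def
    by (intro sum.cong) (simp_all add: sum_interval_upd s_def algebra_simps del: fun_upd_apply)
  also have "\<dots> = (\<beta> + s) * f x * g s * (\<Sum>j = 1..n. a j) - (\<beta> + s) * g (s + 1) * raise n a 1 f x
      + (f x * g s * s - g (s - 1) * lower n 1 f x)"
    by (simp add: sum.distrib sum_subtractf raise_def lower_def s_def flip: sum_distrib_left)
  also have "\<dots> = f x * ((\<Sum>j = 1..n. a j) * (\<beta> + s) * (g s - g (s + 1)) + s * g s - (s - real d) * g (s - 1))"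
  proof -
    have "lower n 1 f x = (s - real d) * f x" "raise n a 1 f x = (\<Sum>j = 1..n. a j) * f x"
      using assms by (simp_all add: ladder_eigen_def s_def)
    note eigen = this
    show ?thesis
      unfolding eigen by (simp add: algebra_simps)
  qed
  finally show ?thesis
    by (simp add: s_def Let_def)
qed

text \<open>
  The Meixner equation with parameter \<open>\<beta> + d\<close> and variable \<open>t = |x| - d\<close>, where \<open>d = m\<^sub>1 + \<dots> + m\<^bsub>n-1\<^esub>\<close>,
  contains the coefficient \<open>\<beta> + d + t = \<beta> + |x|\<close> required by \<open>HM0\<close>. In the other part \<open>HM0\<close> has
  \<open>|x| = t + d\<close> in front of the unshifted term, which adds \<open>d\<close> to the eigenvalue.
\<close>

lemma HM0_PM:
  assumes "1 \<le> n" "\<beta> > 0" "\<And>i. i \<in> {1..n} \<Longrightarrow> a i > 0"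
  shows "HM0 n a \<beta> (PM n a \<beta> m) x
    = (real (m 0) * (1 - (\<Sum>i = 1..n. a i)) + real (\<Sum>j = 1..n - 1. m j)) * PM n a \<beta> m x"
proof -
  define d where "d = (\<Sum>j = 1..n - 1. m j)"
  define c where "c = (\<Sum>i = 1..n. a i)"
  define s where "s = (\<Sum>i = 1..n. x i)"
  define M where "M t = meixner (m 0) t c (\<beta> + real d)" for t
  have "c > 0"
    unfolding c_def using assms by (intro sum_pos) auto
  have nz: "a l \<noteq> 0" if "l \<in> {1..n}" for l
    using assms(3)[OF that] by simp
  have PM: "PM n a \<beta> m = (\<lambda>y. type_two_prod n a m 1 y * M ((\<Sum>i = 1..n. y i) - real d))"
    by (simp add: PM_eq_type_two_prod M_def c_def d_def fun_eq_iff)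
  have "c * (\<beta> + s) * (M (s - real d) - M (s - real d + 1))
      + (s - real d) * (M (s - real d) - M (s - real d - 1)) = real (m 0) * (1 - c) * M (s - real d)"
    using meixner_difference_equation[of c "\<beta> + real d" "s - real d" "m 0"] \<open>c > 0\<close> assms(2)
    by (simp add: M_def)
  then have radial: "c * (\<beta> + s) * (M (s - real d) - M (s + 1 - real d)) + s * M (s - real d)
      - (s - real d) * M (s - 1 - real d) = (real (m 0) * (1 - c) + real d) * M (s - real d)"
    by (simp add: algebra_simps)
  have eigen: "ladder_eigen n a 1 d (type_two_prod n a m 1)"
    unfolding d_def by (rule ladder_eigen_type_two_prod) (use assms(1) nz in auto)
  have "HM0 n a \<beta> (PM n a \<beta> m) x = (real (m 0) * (1 - c) + real d) * PM n a \<beta> m x"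
    unfolding PM HM0_ladder_eigen[OF eigen, where g = "\<lambda>t. M (t - real d)"] Let_def
      s_def[symmetric] c_def[symmetric] radial
    by simp
  then show ?thesis
    by (simp only: c_def d_def)
qed

lemma HMT_PM:
  assumes "1 \<le> n" "\<beta> > 0" "\<And>i. i \<in> {1..n} \<Longrightarrow> a i > 0"
  shows "HMT n a \<beta> (PM n a \<beta> m) x
    = real (\<Sum>j = 0..n - 1. m j) * (1 - (\<Sum>i = 1..n. a i)) * PM n a \<beta> m x"
proof -
  define d where "d = (\<Sum>j = 1..n - 1. m j)"
  have "a l \<noteq> 0" if "l \<in> {1..n}" for l
    using assms(3)[OF that] by simp
  then have "HM_sub n a 1 (PM n a \<beta> m) x = - real d * (\<Sum>i = 1..n. a i) * PM n a \<beta> m x"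
    unfolding d_def by (intro HM_sub_PM) (use assms(1) in auto)
  moreover have "HM0 n a \<beta> (PM n a \<beta> m) x
      = (real (m 0) * (1 - (\<Sum>i = 1..n. a i)) + real d) * PM n a \<beta> m x"
    unfolding d_def by (rule HM0_PM) (use assms in auto)
  moreover have "(\<Sum>j = 0..n - 1. m j) = m 0 + d"
    by (simp add: d_def sum.atLeast_Suc_atMost)
  ultimately show ?thesis
    by (simp add: HMT_def algebra_simps)
qed

section \<open>Polynomials filtered by degree\<close>

definition monom_fun :: "nat \<Rightarrow> (nat \<Rightarrow> nat) \<Rightarrow> (nat \<Rightarrow> real) \<Rightarrow> real" where
  "monom_fun n k x = (\<Prod>i = 1..n. x i ^ k i)"

text \<open>
  The filtration by total degree, needed because completeness is proved by counting dimensions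
  degree by degree.
\<close>

definition poly_upto :: "nat \<Rightarrow> nat \<Rightarrow> ((nat \<Rightarrow> real) \<Rightarrow> real) set" where
  "poly_upto n d = span (monom_fun n ` {k. (\<Sum>i = 1..n. k i) \<le> d})"

lemma poly_upto_mono: "d \<le> e \<Longrightarrow> f \<in> poly_upto n d \<Longrightarrow> f \<in> poly_upto n e"
  unfolding poly_upto_def by (erule rev_subsetD) (intro span_mono, auto)

lemma poly_upto_monom: "(\<Sum>i = 1..n. k i) \<le> d \<Longrightarrow> monom_fun n k \<in> poly_upto n d"
  unfolding poly_upto_def by (intro span_base) auto

lemma poly_upto_add:
  "f \<in> poly_upto n d \<Longrightarrow> g \<in> poly_upto n d \<Longrightarrow> (\<lambda>x. f x + g x) \<in> poly_upto n d"
  unfolding poly_upto_def using span_add[of f _ g] by (simp add: plus_fun_def)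

lemma poly_upto_cmult: "f \<in> poly_upto n d \<Longrightarrow> (\<lambda>x. c * f x) \<in> poly_upto n d"
  unfolding poly_upto_def using span_scale[of f _ c] by (simp add: scaleR_fun_def)

lemma poly_upto_const: "(\<lambda>x. c) \<in> poly_upto n d"
proof -
  have "monom_fun n (\<lambda>_. 0) \<in> poly_upto n d"
    by (rule poly_upto_monom) simp
  from poly_upto_cmult[OF this, of c] show ?thesis
    by (simp add: monom_fun_def)
qed

lemma poly_upto_sum:
  "(\<And>i. i \<in> A \<Longrightarrow> f i \<in> poly_upto n d) \<Longrightarrow> (\<lambda>x. \<Sum>i\<in>A. f i x) \<in> poly_upto n d"
  by (induction A rule: infinite_finite_induct) (auto intro: poly_upto_add poly_upto_const)

lemma poly_upto_coord:
  assumes "i \<in> {1..n}"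
  shows "(\<lambda>x. x i) \<in> poly_upto n 1"
proof -
  have "monom_fun n (\<lambda>j. if j = i then 1 else 0) = (\<lambda>x. x i)"
    using assms by (auto simp: monom_fun_def fun_eq_iff if_distrib[of "power _"] cong: if_cong)
  then show ?thesis
    using assms poly_upto_monom[of "\<lambda>j. if j = i then 1 else 0" n 1] by simp
qed

lemma poly_upto_mult:
  assumes "f \<in> poly_upto n d" "g \<in> poly_upto n e"
  shows "(\<lambda>x. f x * g x) \<in> poly_upto n (d + e)"
proof -
  have monom: "(\<lambda>x. monom_fun n k x * h x) \<in> poly_upto n (d + e)"
    if "(\<Sum>i = 1..n. k i) \<le> d" "h \<in> poly_upto n e" for k h
    using that(2) unfolding poly_upto_def[of n e]
  proof (induction h rule: span_induct_alt)
    case base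
    then show ?case
      by (simp add: zero_fun_def poly_upto_const)
  next
    case (step c g h)
    then obtain l where l: "g = monom_fun n l" "(\<Sum>i = 1..n. l i) \<le> e"
      by auto
    have "monom_fun n (\<lambda>i. k i + l i) \<in> poly_upto n (d + e)"
      using that(1) l(2) by (intro poly_upto_monom) (simp add: sum.distrib)
    then have "(\<lambda>x. c * monom_fun n (\<lambda>i. k i + l i) x + monom_fun n k x * h x) \<in> poly_upto n (d + e)"
      by (intro poly_upto_add poly_upto_cmult step)
    then show ?case
      by (simp add: l(1) monom_fun_def power_add prod.distrib scaleR_fun_def plus_fun_def algebra_simps)
  qed
  show ?thesis
    using assms(1) unfolding poly_upto_def[of n d]
  proof (induction f rule: span_induct_alt)
    case base
    then show ?case
      by (simp add: zero_fun_def poly_upto_const)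
  next
    case (step c h f)
    then obtain k where "h = monom_fun n k" "(\<Sum>i = 1..n. k i) \<le> d"
      by auto
    then have "(\<lambda>x. c * (h x * g x) + f x * g x) \<in> poly_upto n (d + e)"
      using monom assms(2) by (intro poly_upto_add poly_upto_cmult step) auto
    then show ?case
      by (simp add: scaleR_fun_def plus_fun_def algebra_simps)
  qed
qed

lemma poly_upto_prod:
  assumes "\<And>i. i \<in> A \<Longrightarrow> f i \<in> poly_upto n (d i)"
  shows "(\<lambda>x. \<Prod>i\<in>A. f i x) \<in> poly_upto n (\<Sum>i\<in>A. d i)"
  using assms
  by (induction A rule: infinite_finite_induct) (auto intro: poly_upto_const poly_upto_mult)

lemma poly_upto_power: "f \<in> poly_upto n d \<Longrightarrow> (\<lambda>x. f x ^ k) \<in> poly_upto n (k * d)"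
  by (induction k) (auto intro: poly_upto_const poly_upto_mult)

lemma poly_upto_pochhammer:
  assumes "f \<in> poly_upto n 1"
  shows "(\<lambda>x. pochhammer (f x) k) \<in> poly_upto n k"
proof (induction k)
  case (Suc k)
  have "(\<lambda>x. pochhammer (f x) k * (f x + real k)) \<in> poly_upto n (k + 1)"
    by (intro poly_upto_mult Suc poly_upto_add assms poly_upto_const)
  then show ?case
    by (simp add: pochhammer_Suc)
qed (simp add: poly_upto_const)

lemma poly_upto_affine:
  assumes "1 \<le> i"
  shows "(\<lambda>x. c * (\<Sum>j = i..n. x j) + e) \<in> poly_upto n 1"
  using assms by (intro poly_upto_add poly_upto_cmult poly_upto_const poly_upto_sum poly_upto_coord) auto

lemma poly_upto_translate:
  assumes "f \<in> poly_upto n d"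
  shows "(\<lambda>x. f (x(j := x j + c))) \<in> poly_upto n d"
  using assms[unfolded poly_upto_def]
proof (induction f rule: span_induct_alt)
  case base
  then show ?case
    by (simp add: zero_fun_def poly_upto_const)
next
  case (step b g f)
  then obtain k where k: "g = monom_fun n k" "(\<Sum>i = 1..n. k i) \<le> d"
    by auto
  have coord: "(\<lambda>x. (x(j := x j + c)) i) \<in> poly_upto n 1" if "i \<in> {1..n}" for i
    using that poly_upto_add[OF poly_upto_coord poly_upto_const, of j n c] poly_upto_coord[of i n]
    by (cases "i = j") auto
  have "(\<lambda>x. (x(j := x j + c)) i ^ k i) \<in> poly_upto n (k i)" if "i \<in> {1..n}" for i
    using poly_upto_power[OF coord[OF that], of "k i"] by (simp del: fun_upd_apply)
  then have "(\<lambda>x. \<Prod>i = 1..n. (x(j := x j + c)) i ^ k i) \<in> poly_upto n (\<Sum>i = 1..n. k i)"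
    by (rule poly_upto_prod)
  then have "(\<lambda>x. g (x(j := x j + c))) \<in> poly_upto n d"
    unfolding k(1) monom_fun_def using k(2) by (rule poly_upto_mono[rotated])
  then have "(\<lambda>x. b * g (x(j := x j + c)) + f (x(j := x j + c))) \<in> poly_upto n d"
    by (intro poly_upto_add poly_upto_cmult step)
  then show ?case
    by (simp add: scaleR_fun_def plus_fun_def del: fun_upd_apply)
qed

lemma poly_space_eq_Union: "poly_space n = (\<Union>d. poly_upto n d)"
proof
  have monoms: "{(\<lambda>x. \<Prod>i = 1..n. x i ^ k i) | k :: nat \<Rightarrow> nat. True} = range (monom_fun n)"
    by (auto simp: monom_fun_def fun_eq_iff image_iff)
  show "(\<Union>d. poly_upto n d) \<subseteq> poly_space n"
    unfolding poly_space_def monoms poly_upto_def by (intro UN_least span_mono) auto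
  show "poly_space n \<subseteq> (\<Union>d. poly_upto n d)"
  proof
    fix f assume "f \<in> poly_space n"
    then show "f \<in> (\<Union>d. poly_upto n d)"
      unfolding poly_space_def monoms
    proof (induction f rule: span_induct_alt)
      case base
      then show ?case
        by (simp add: zero_fun_def poly_upto_const)
    next
      case (step c g f)
      then obtain d k where dk: "f \<in> poly_upto n d" "g = monom_fun n k"
        by auto
      then have "(\<lambda>x. c * g x + f x) \<in> poly_upto n (max d (\<Sum>i = 1..n. k i))"
        by (intro poly_upto_add poly_upto_cmult) (auto intro: poly_upto_mono[OF _ dk(1)] poly_upto_monom)
      then show ?case
        by (auto simp: scaleR_fun_def plus_fun_def)
    qed
  qed
qed

text \<open>
  Bounding each factor by its own index gives the total degree bound \<open>m\<^sub>0 + \<dots> + m\<^bsub>n-1\<^esub>\<close>, which the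
  dimension count relies on.
\<close>

lemma PM_poly_upto:
  assumes "1 \<le> n"
  shows "PM n a \<beta> m \<in> poly_upto n (\<Sum>j = 0..n - 1. m j)"
proof -
  define Q where "Q x = (\<Prod>i = 1..n - 1. type_two (m i) (x i)
      ((\<Sum>j = i + 1..n. x j) - real (\<Sum>j = i + 1..n - 1. m j)) (a i) (\<Sum>j = i + 1..n. a j))" for x
  define M where "M x = meixner (m 0) ((\<Sum>i = 1..n. x i) - real (\<Sum>j = 1..n - 1. m j))
      (\<Sum>i = 1..n. a i) (\<beta> + real (\<Sum>j = 1..n - 1. m j))" for x :: "nat \<Rightarrow> real"
  have PM: "PM n a \<beta> m = (\<lambda>x. Q x * M x)"
    by (simp add: fun_eq_iff PM_def Q_def M_def)
  have two: "(\<lambda>x. type_two (m i) (x i) ((\<Sum>j = i + 1..n. x j) - c) \<alpha> \<gamma>) \<in> poly_upto n (m i)"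
    if "i \<in> {1..n - 1}" for i c \<alpha> \<gamma>
  proof -
    have u: "(\<lambda>x. - x i) \<in> poly_upto n 1"
      using poly_upto_cmult[OF poly_upto_coord[of i n], of "- 1"] that by auto
    have v: "(\<lambda>x. - ((\<Sum>j = i + 1..n. x j) - c)) \<in> poly_upto n 1"
      using poly_upto_affine[of "i + 1" "- 1" n c] by simp
    have "(\<lambda>x. ((-1) ^ k * real (m i choose k) * (\<gamma> / \<alpha>) ^ k) * pochhammer (- x i) k
        * pochhammer (- ((\<Sum>j = i + 1..n. x j) - c)) (m i - k)) \<in> poly_upto n (m i)" if "k \<le> m i" for k
    proof (rule poly_upto_mono)
      show "k + (m i - k) \<le> m i"
        using that by simp
    qed (intro poly_upto_mult poly_upto_cmult poly_upto_pochhammer u v)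
    then show ?thesis
      unfolding type_two_def by (intro poly_upto_sum) simp
  qed
  have "(\<lambda>x. - ((\<Sum>i = 1..n. x i) - c)) \<in> poly_upto n 1" for c
    using poly_upto_affine[of 1 "- 1" n c] by simp
  then have "(\<lambda>x. meixner (m 0) ((\<Sum>i = 1..n. x i) - c) b e) \<in> poly_upto n (m 0)" for b c e
    unfolding meixner_eq_sum
    by (intro poly_upto_sum poly_upto_cmult) (auto intro: poly_upto_mono[OF _ poly_upto_pochhammer])
  then have M: "M \<in> poly_upto n (m 0)"
    unfolding M_def .
  have "Q \<in> poly_upto n (\<Sum>j = 1..n - 1. m j)"
    unfolding Q_def by (rule poly_upto_prod) (rule two)
  from poly_upto_mult[OF this M]
  have "PM n a \<beta> m \<in> poly_upto n ((\<Sum>j = 1..n - 1. m j) + m 0)"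
    unfolding PM .
  then show ?thesis
    by (simp add: sum.atLeast_Suc_atMost add.commute)
qed

section \<open>Convergence of the weighted sums\<close>

text \<open>
  Raise Bernoulli's inequality \<open>x (t - 1) \<le> t\<^sup>x\<close> to the power \<open>k\<close>, where \<open>t > 1\<close> is so small that \<open>t\<^sup>k \<le> r\<close>.
\<close>

lemma real_power_le_geometric:
  fixes r :: real
  assumes "r > 1"
  obtains C where "C \<ge> 0" "\<And>x. real x ^ k \<le> C * r ^ x"
proof
  \<comment> \<open>The root of order \<open>k + 1\<close> exists for \<open>k = 0\<close> as well.\<close>
  define t where "t = root (Suc k) r"
  have "t > 1"
    using assms by (simp add: t_def real_root_gt_1_iff del: real_root_Suc_0)
  have "t ^ k \<le> r"
  proof -
    have "t ^ k \<le> t ^ Suc k"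
      using \<open>t > 1\<close> by (intro power_increasing) auto
    also have "t ^ Suc k = r"
      unfolding t_def using assms by (intro real_root_pow_pos2) auto
    finally show ?thesis .
  qed
  show "1 / (t - 1) ^ k \<ge> 0"
    using \<open>t > 1\<close> by simp
  fix x
  have "real x * (t - 1) \<le> t ^ x"
    using Bernoulli_inequality[of "t - 1" x] \<open>t > 1\<close> by simp
  then have "(real x * (t - 1)) ^ k \<le> (t ^ x) ^ k"
    using \<open>t > 1\<close> by (intro power_mono) auto
  also have "\<dots> = (t ^ k) ^ x"
    by (simp add: mult.commute flip: power_mult)
  also have "\<dots> \<le> r ^ x"
    using \<open>t ^ k \<le> r\<close> \<open>t > 1\<close> by (intro power_mono) auto
  finally show "real x ^ k \<le> 1 / (t - 1) ^ k * r ^ x"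
    using \<open>t > 1\<close> by (simp add: power_mult_distrib pos_le_divide_eq)
qed

lemma negative_binomial_sums:
  fixes \<beta> q :: real
  assumes "\<bar>q\<bar> < 1"
  shows "(\<lambda>k. pochhammer \<beta> k / fact k * q ^ k) sums (1 - q) powr (- \<beta>)"
proof -
  have "((- \<beta>) gchoose k) * (- q) ^ k = pochhammer \<beta> k / fact k * q ^ k" for k
    by (simp add: gbinomial_pochhammer power_minus[of q])
  then show ?thesis
    using gen_binomial_real[of "- q" "- \<beta>"] assms by simp
qed

text \<open>
  Induction on the index set: \<open>(\<beta>)\<^bsub>k+s\<^esub> = (\<beta>)\<^sub>k (\<beta> + k)\<^sub>s\<close>, so the sum over the old indices is the same series with
  parameter \<open>\<beta> + k\<close>, and the remaining sum over \<open>k\<close> is a negative binomial series with ratio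
  \<open>b\<^sub>i / (1 - \<Sum> b)\<close>. The parameter must therefore vary in the induction.
\<close>

lemma negative_multinomial_has_sum:
  fixes \<beta> :: real and b :: "'i \<Rightarrow> real"
  assumes "finite I" "\<beta> > 0" "\<And>i. i \<in> I \<Longrightarrow> b i \<ge> 0" "sum b I < 1"
  shows "((\<lambda>x. pochhammer \<beta> (sum x I) * (\<Prod>i\<in>I. b i ^ x i / fact (x i)))
            has_sum (1 - sum b I) powr (- \<beta>)) (I \<rightarrow>\<^sub>E UNIV)"
  using assms
proof (induction I arbitrary: \<beta> rule: finite_induct)
  case empty
  then show ?case
    by (simp add: PiE_empty_domain has_sum_finite_iff)
next
  case (insert i I)
  define B where "B = sum b I"
  define q where "q = b i / (1 - B)"
  have bi: "b i \<ge> 0" "b i + B < 1"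
    using insert.prems insert.hyps by (auto simp: B_def)
  then have B1: "0 < 1 - B" "B < 1"
    by simp_all
  have q: "0 \<le> q" "q < 1"
    using bi B1 by (auto simp: q_def field_simps)
  define F where "F \<beta> x = pochhammer \<beta> (sum x I) * (\<Prod>i\<in>I. b i ^ x i / fact (x i))"
    for \<beta> and x :: "'i \<Rightarrow> nat"
  define G where "G = (\<lambda>(k, x). pochhammer \<beta> k * b i ^ k / fact k * F (\<beta> + real k) x)"
  have F: "(F \<gamma> has_sum (1 - B) powr (- \<gamma>)) (I \<rightarrow>\<^sub>E UNIV)" if "\<gamma> > 0" for \<gamma>
    unfolding F_def B_def using insert.IH[OF that] insert.prems(2) B1(2) by (simp add: B_def)
  have inner: "((\<lambda>x. G (k, x)) has_sum pochhammer \<beta> k * b i ^ k / fact k * (1 - B) powr (- (\<beta> + real k)))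
      (I \<rightarrow>\<^sub>E UNIV)" for k
    unfolding G_def prod.case using insert.prems by (intro has_sum_cmult_right F) auto
  have inner_eq: "pochhammer \<beta> k * b i ^ k / fact k * (1 - B) powr (- (\<beta> + real k))
      = (1 - B) powr (- \<beta>) * (pochhammer \<beta> k / fact k * q ^ k)" for k
    using B1 by (simp add: q_def powr_diff powr_realpow power_divide)
  have "((\<lambda>k. pochhammer \<beta> k / fact k * q ^ k) has_sum (1 - q) powr (- \<beta>)) UNIV"
    using negative_binomial_sums[of q \<beta>] q insert.prems(1)
    by (intro sums_nonneg_imp_has_sum) (auto intro!: mult_nonneg_nonneg divide_nonneg_nonneg pochhammer_nonneg)
  then have "((\<lambda>k. (1 - B) powr (- \<beta>) * (pochhammer \<beta> k / fact k * q ^ k))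
      has_sum (1 - B) powr (- \<beta>) * (1 - q) powr (- \<beta>)) UNIV"
    by (rule has_sum_cmult_right)
  also have "(1 - B) powr (- \<beta>) * (1 - q) powr (- \<beta>) = ((1 - B) * (1 - q)) powr (- \<beta>)"
    using B1 q by (simp add: powr_mult)
  also have "(1 - B) * (1 - q) = 1 - sum b (insert i I)"
    using B1 insert.hyps by (simp add: q_def B_def field_simps)
  finally have outer: "((\<lambda>k. pochhammer \<beta> k * b i ^ k / fact k * (1 - B) powr (- (\<beta> + real k)))
      has_sum (1 - sum b (insert i I)) powr (- \<beta>)) UNIV"
    unfolding inner_eq .
  have "G (k, x) \<ge> 0" for k x
    using insert.prems bi unfolding G_def F_def prod.case
    by (intro mult_nonneg_nonneg divide_nonneg_nonneg pochhammer_nonneg prod_nonneg) auto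
  then have "G summable_on (UNIV \<times> (I \<rightarrow>\<^sub>E UNIV))"
    using inner outer by (intro summable_on_SigmaI) (auto simp: has_sum_imp_summable)
  then have "(G has_sum (1 - sum b (insert i I)) powr (- \<beta>)) (UNIV \<times> (I \<rightarrow>\<^sub>E UNIV))"
    using inner outer by (intro has_sum_SigmaI)
  moreover have "G = (\<lambda>x. pochhammer \<beta> (sum x (insert i I)) * (\<Prod>i\<in>insert i I. b i ^ x i / fact (x i)))
      \<circ> (\<lambda>(k, x). x(i := k))"
  proof -
    have sums: "sum (x(i := k)) I = sum x I"
      and prods: "(\<Prod>j\<in>I. b j ^ (x(i := k)) j / fact ((x(i := k)) j)) = (\<Prod>j\<in>I. b j ^ x j / fact (x j))"
      for k and x :: "'i \<Rightarrow> nat"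
      using insert.hyps by (auto intro!: sum.cong prod.cong)
    have "G (k, x) = pochhammer \<beta> (sum (x(i := k)) (insert i I))
        * (\<Prod>j\<in>insert i I. b j ^ (x(i := k)) j / fact ((x(i := k)) j))" for k x
      unfolding sum.insert[OF insert.hyps] prod.insert[OF insert.hyps] sums prods
      by (simp add: G_def F_def pochhammer_product')
    then show ?thesis
      by (simp add: fun_eq_iff del: fun_upd_apply)
  qed
  ultimately show ?case
    unfolding PiE_insert_eq
    using has_sum_reindex[OF inj_combinator[OF insert.hyps(2), where T = "\<lambda>_. UNIV :: nat set"]]
    by blast
qed

text \<open>
  On the lattice a monomial is dominated by a multiple of \<open>r\<^bsup>|x|\<^esup>\<close> for any \<open>r > 1\<close>, and \<open>r\<^bsup>|x|\<^esup> W(x)\<close> is again a negative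
  multinomial weight, with parameters \<open>r a\<^sub>i\<close>; it is summable as long as \<open>r |a| < 1\<close>.
\<close>

lemma summable_WM_poly:
  assumes "\<beta> > 0" "\<And>i. i \<in> {1..n} \<Longrightarrow> a i > 0" "(\<Sum>i = 1..n. a i) < 1" "f \<in> poly_space n"
  shows "(\<lambda>x. f (\<lambda>i. real (x i)) * WM n a \<beta> x) summable_on lattice n"
  using assms(4) unfolding poly_space_def
proof (induction f rule: span_induct_alt)
  case base
  then show ?case
    by simp
next
  case (step c g f)
  then obtain k where g: "g = (\<lambda>x. \<Prod>i = 1..n. x i ^ k i)"
    by auto
  define A where "A = (\<Sum>i = 1..n. a i)"
  \<comment> \<open>The harmonic mean of \<open>1\<close> and \<open>1 / A\<close>, written so as to cover \<open>A = 0\<close>, the case \<open>n = 0\<close>.\<close>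
  define r where "r = 2 / (1 + A)"
  have "A \<ge> 0"
    unfolding A_def using assms(2) by (intro sum_nonneg less_imp_le)
  moreover have "A < 1"
    using assms(3) by (simp add: A_def)
  ultimately have "r > 1" "r * A < 1"
    by (auto simp: r_def field_simps)
  have "\<exists>C. C \<ge> 0 \<and> (\<forall>x. real x ^ k i \<le> C * r ^ x)" for i
    using real_power_le_geometric[OF \<open>r > 1\<close>] by metis
  then obtain C where C: "\<And>i. C i \<ge> 0" "\<And>i x. real x ^ k i \<le> C i * r ^ x"
    by metis
  define V where "V x = pochhammer \<beta> (sum x {1..n}) * (\<Prod>i = 1..n. (r * a i) ^ x i / fact (x i))" for x
  have "V summable_on lattice n"
    unfolding V_def lattice_def
    using negative_multinomial_has_sum[of "{1..n}" \<beta> "\<lambda>i. r * a i"] assms(1,2) \<open>r > 1\<close> \<open>r * A < 1\<close>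
    by (intro has_sum_imp_summable) (auto simp: A_def less_imp_le simp flip: sum_distrib_left)
  then have "(\<lambda>x. ((\<Prod>i = 1..n. C i) * (1 - A) powr \<beta>) * V x) summable_on lattice n"
    by (rule summable_on_cmult_right)
  then have "(\<lambda>x. g (\<lambda>i. real (x i)) * WM n a \<beta> x) summable_on lattice n"
  proof (rule summable_on_comparison_test)
    fix x
    define w where "w = pochhammer \<beta> (sum x {1..n}) * (\<Prod>i = 1..n. a i ^ x i / fact (x i)) * (1 - A) powr \<beta>"
    have W: "WM n a \<beta> x = w"
      by (simp add: WM_def w_def A_def prod_dividef)
    have "w \<ge> 0"
      unfolding w_def using assms(1,2)
      by (intro mult_nonneg_nonneg pochhammer_nonneg prod_nonneg divide_nonneg_nonneg zero_le_power powr_ge_zero)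
        (auto intro: less_imp_le)
    moreover have "g (\<lambda>i. real (x i)) \<ge> 0"
      unfolding g by (intro prod_nonneg) auto
    ultimately show "g (\<lambda>i. real (x i)) * WM n a \<beta> x \<ge> 0"
      by (simp add: W)
    have "g (\<lambda>i. real (x i)) \<le> (\<Prod>i = 1..n. C i * r ^ x i)"
      unfolding g using C(2) by (intro prod_mono) auto
    then have "g (\<lambda>i. real (x i)) * w \<le> (\<Prod>i = 1..n. C i * r ^ x i) * w"
      using \<open>w \<ge> 0\<close> by (intro mult_right_mono)
    also have "\<dots> = ((\<Prod>i = 1..n. C i) * (1 - A) powr \<beta>) * V x"
      by (simp add: w_def V_def prod.distrib prod_dividef power_mult_distrib)
    finally show "g (\<lambda>i. real (x i)) * WM n a \<beta> x \<le> ((\<Prod>i = 1..n. C i) * (1 - A) powr \<beta>) * V x"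
      by (simp add: W)
  qed
  then have "(\<lambda>x. c * (g (\<lambda>i. real (x i)) * WM n a \<beta> x) + f (\<lambda>i. real (x i)) * WM n a \<beta> x) summable_on lattice n"
    by (intro summable_on_add summable_on_cmult_right step)
  then show ?case
    by (simp add: scaleR_fun_def plus_fun_def algebra_simps)
qed

section \<open>Symmetry of the operators and orthogonality\<close>

lemma poly_space_add: "f \<in> poly_space n \<Longrightarrow> g \<in> poly_space n \<Longrightarrow> (\<lambda>x. f x + g x) \<in> poly_space n"
  unfolding poly_space_def using span_add[of f _ g] by (simp add: plus_fun_def)

lemma poly_space_cmult: "f \<in> poly_space n \<Longrightarrow> (\<lambda>x. c * f x) \<in> poly_space n"
  unfolding poly_space_def using span_scale[of f _ c] by (simp add: scaleR_fun_def)

lemma poly_space_diff: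
  assumes "f \<in> poly_space n" "g \<in> poly_space n"
  shows "(\<lambda>x. f x - g x) \<in> poly_space n"
  using poly_space_add[OF assms(1) poly_space_cmult[OF assms(2), of "- 1"]] by simp

lemma poly_space_mult: "f \<in> poly_space n \<Longrightarrow> g \<in> poly_space n \<Longrightarrow> (\<lambda>x. f x * g x) \<in> poly_space n"
  unfolding poly_space_eq_Union using poly_upto_mult by blast

lemma poly_space_const: "(\<lambda>x. c) \<in> poly_space n"
  unfolding poly_space_eq_Union using poly_upto_const by blast

lemma poly_space_coord: "i \<in> {1..n} \<Longrightarrow> (\<lambda>x. x i) \<in> poly_space n"
  unfolding poly_space_eq_Union using poly_upto_coord by blast

lemma poly_space_total: "(\<lambda>x. \<Sum>i = 1..n. x i) \<in> poly_space n"
  unfolding poly_space_eq_Union using poly_upto_affine[of 1 1 n 0] by auto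

lemma poly_space_translate: "f \<in> poly_space n \<Longrightarrow> (\<lambda>x. f (x(j := x j + c))) \<in> poly_space n"
  unfolding poly_space_eq_Union using poly_upto_translate by blast

lemma poly_space_translate_down: "f \<in> poly_space n \<Longrightarrow> (\<lambda>x. f (x(j := x j - 1))) \<in> poly_space n"
  using poly_space_translate[of f n j "- 1"] by simp

lemma poly_space_hop:
  assumes "f \<in> poly_space n" "j \<noteq> k"
  shows "(\<lambda>x. f (x(j := x j - 1, k := x k + 1))) \<in> poly_space n"
  using poly_space_translate_down[OF poly_space_translate[OF assms(1), of k 1], of j] assms(2)
  by simp

lemma poly_space_sum:
  "(\<And>i. i \<in> A \<Longrightarrow> f i \<in> poly_space n) \<Longrightarrow> (\<lambda>x. \<Sum>i\<in>A. f i x) \<in> poly_space n"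
  by (induction A rule: infinite_finite_induct) (auto intro: poly_space_add poly_space_const)

lemmas poly_space_intros = poly_space_add poly_space_cmult poly_space_diff poly_space_mult
  poly_space_const poly_space_coord poly_space_total poly_space_translate poly_space_translate_down
  poly_space_hop

locale meixner_system =
  fixes n :: nat and \<beta> :: real and a :: "nat \<Rightarrow> real"
  assumes n_pos: "1 \<le> n" and beta_pos: "\<beta> > 0"
    and a_pos: "\<And>i. i \<in> {1..n} \<Longrightarrow> a i > 0" and a_sum: "(\<Sum>i = 1..n. a i) < 1"
begin

text \<open>
  The linear functional behind the inner product: \<open>ip p q\<close> is its value at the product of \<open>p\<close> and \<open>q\<close>.
\<close>

definition wsum :: "((nat \<Rightarrow> real) \<Rightarrow> real) \<Rightarrow> real" where
  "wsum f = (\<Sum>\<^sub>\<infinity>x\<in>lattice n. f (\<lambda>i. real (x i)) * WM n a \<beta> x)"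

lemma wsum_summable:
  "f \<in> poly_space n \<Longrightarrow> (\<lambda>x. f (\<lambda>i. real (x i)) * WM n a \<beta> x) summable_on lattice n"
  by (rule summable_WM_poly) (use beta_pos a_pos a_sum in auto)

lemma wsum_cmult: "wsum (\<lambda>x. c * f x) = c * wsum f"
  unfolding wsum_def by (simp add: mult.assoc infsum_cmult_right')

lemma wsum_add:
  assumes "f \<in> poly_space n" "g \<in> poly_space n"
  shows "wsum (\<lambda>x. f x + g x) = wsum f + wsum g"
  unfolding wsum_def
  using infsum_add[OF wsum_summable[OF assms(1)] wsum_summable[OF assms(2)]]
  by (simp add: distrib_right)

lemma wsum_diff:
  assumes "f \<in> poly_space n" "g \<in> poly_space n"
  shows "wsum (\<lambda>x. f x - g x) = wsum f - wsum g"
  using wsum_add[OF assms(1) poly_space_cmult[OF assms(2), of "- 1"]] wsum_cmult[of "- 1" g]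
  by simp

lemma wsum_sum:
  assumes "finite A" "\<And>i. i \<in> A \<Longrightarrow> f i \<in> poly_space n"
  shows "wsum (\<lambda>x. \<Sum>i\<in>A. f i x) = (\<Sum>i\<in>A. wsum (f i))"
  using assms
proof (induction A rule: finite_induct)
  case empty
  then show ?case by (simp add: wsum_def)
next
  case (insert i A)
  then show ?case
    using wsum_add[of "f i" "\<lambda>x. \<Sum>i\<in>A. f i x"] poly_space_sum[of A f] by simp
qed

text \<open>
  The first-order recurrence (Pearson equation) of the weight.
\<close>

lemma WM_step:
  assumes "j \<in> {1..n}"
  shows "real (Suc (y j)) * WM n a \<beta> (y(j := Suc (y j))) = (\<beta> + (\<Sum>i = 1..n. real (y i))) * a j * WM n a \<beta> y"
proof -
  have prods: "(\<Prod>i = 1..n. g i ((y(j := v)) i)) = g j v * (\<Prod>i\<in>{1..n} - {j}. g i (y i))"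
    for g :: "nat \<Rightarrow> nat \<Rightarrow> real" and v
    using prod.remove[OF finite_atLeastAtMost assms, of "\<lambda>i. g i ((y(j := v)) i)"] by simp
  have sums: "(\<Sum>i = 1..n. (y(j := v)) i) = v + (\<Sum>i\<in>{1..n} - {j}. y i)" for v
    using sum.remove[OF finite_atLeastAtMost assms, of "y(j := v)"] by simp
  define s where "s = (\<Sum>i = 1..n. y i)"
  have s: "(\<Sum>i = 1..n. (y(j := Suc (y j))) i) = Suc s" "(\<Sum>i = 1..n. real (y i)) = real s"
    using sums[of "Suc (y j)"] sums[of "y j"] by (simp_all add: s_def del: fun_upd_apply flip: of_nat_sum)
  have A: "(\<Prod>i = 1..n. a i ^ (y(j := Suc (y j))) i) = a j * (\<Prod>i = 1..n. a i ^ y i)"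
    using prods[of "\<lambda>i k. a i ^ k" "Suc (y j)"] prods[of "\<lambda>i k. a i ^ k" "y j"] by simp
  have F: "(\<Prod>i = 1..n. fact ((y(j := Suc (y j))) i)) = real (Suc (y j)) * (\<Prod>i = 1..n. fact (y i))"
    using prods[of "\<lambda>i k. fact k" "Suc (y j)"] prods[of "\<lambda>i k. fact k" "y j"] by simp
  show ?thesis
    unfolding WM_def s A F s_def[symmetric] pochhammer_Suc
    by (simp add: mult_ac del: of_nat_Suc)
qed

text \<open>
  Substitute \<open>x = y + e\<^sub>j\<close>; the points with \<open>x\<^sub>j = 0\<close>, which are not reached, contribute nothing. This
  adjointness of multiplication by \<open>x\<^sub>j\<close> and the shift by \<open>e\<^sub>j\<close> is the only property of the weight used for
  the symmetry of the operators.
\<close>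

lemma wsum_shift:
  assumes "j \<in> {1..n}"
  shows "wsum (\<lambda>x. x j * f x) = wsum (\<lambda>x. (\<beta> + (\<Sum>i = 1..n. x i)) * a j * f (x(j := x j + 1)))"
proof -
  define up where "up y = y(j := Suc (y j))" for y :: "nat \<Rightarrow> nat"
  define h where "h x = real (x j) * f (\<lambda>i. real (x i)) * WM n a \<beta> x" for x
  have inj: "inj_on up (lattice n)"
    by (rule inj_onI) (metis fun_upd_eqD fun_upd_triv fun_upd_upd nat.inject up_def)
  have image: "up ` lattice n = {x \<in> lattice n. x j \<noteq> 0}"
  proof
    show "up ` lattice n \<subseteq> {x \<in> lattice n. x j \<noteq> 0}"
      using assms by (auto simp: lattice_def up_def PiE_iff extensional_def)
    show "{x \<in> lattice n. x j \<noteq> 0} \<subseteq> up ` lattice n"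
    proof
      fix x assume x: "x \<in> {x \<in> lattice n. x j \<noteq> 0}"
      then have "x = up (x(j := x j - 1))" "x(j := x j - 1) \<in> lattice n"
        using assms by (auto simp: lattice_def up_def PiE_iff extensional_def)
      then show "x \<in> up ` lattice n" by blast
    qed
  qed
  have "wsum (\<lambda>x. x j * f x) = infsum h (lattice n)"
    by (simp add: wsum_def h_def[abs_def])
  also have "\<dots> = infsum h (up ` lattice n)"
    unfolding image by (rule infsum_cong_neutral) (auto simp: h_def)
  also have "\<dots> = infsum (h \<circ> up) (lattice n)"
    by (rule infsum_reindex[OF inj])
  also have "\<dots> = wsum (\<lambda>x. (\<beta> + (\<Sum>i = 1..n. x i)) * a j * f (x(j := x j + 1)))"
    unfolding wsum_def
  proof (rule infsum_cong)
    fix y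
    have "(\<lambda>i. real (up y i)) = (\<lambda>i. real (y i))(j := real (y j) + 1)"
      by (auto simp: up_def)
    then show "(h \<circ> up) y = (\<beta> + (\<Sum>i = 1..n. real (y i))) * a j * f ((\<lambda>i. real (y i))(j := real (y j) + 1))
        * WM n a \<beta> y"
      using WM_step[OF assms, of y] by (simp add: h_def up_def mult_ac del: of_nat_Suc)
  qed
  finally show ?thesis .
qed

text \<open>
  The integrand is a sum over \<open>j\<close> of differences of two functions which the substitution
  \<open>x = y + e\<^sub>j\<close> carries into each other.
\<close>

lemma wsum_HM0_symmetric:
  assumes "p \<in> poly_space n" "q \<in> poly_space n"
  shows "wsum (\<lambda>x. q x * HM0 n a \<beta> p x - p x * HM0 n a \<beta> q x) = 0"
proof -
  define F where "F j x = p x * q (x(j := x j - 1)) - p (x(j := x j - 1)) * q x" for j x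
  define D where "D j x = x j * F j x - (\<beta> + (\<Sum>i = 1..n. x i)) * a j * F j (x(j := x j + 1))" for j x
  have F: "F j \<in> poly_space n" for j
    unfolding F_def by (intro poly_space_intros assms)
  have DF: "(\<lambda>x. x j * F j x) \<in> poly_space n"
    "(\<lambda>x. (\<beta> + (\<Sum>i = 1..n. x i)) * a j * F j (x(j := x j + 1))) \<in> poly_space n" if "j \<in> {1..n}" for j
    by (intro poly_space_intros F that)+
  have "q x * HM0 n a \<beta> p x - p x * HM0 n a \<beta> q x = (\<Sum>j = 1..n. D j x)" for x
    unfolding HM0_def sum_distrib_left sum_subtractf[symmetric]
    by (intro sum.cong refl) (simp add: D_def F_def algebra_simps)
  moreover have "wsum (\<lambda>x. \<Sum>j = 1..n. D j x) = (\<Sum>j = 1..n. wsum (D j))"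
    by (rule wsum_sum) (use DF poly_space_diff in \<open>auto simp: D_def\<close>)
  moreover have "wsum (D j) = 0" if "j \<in> {1..n}" for j
    unfolding D_def using wsum_diff[OF DF[OF that]] wsum_shift[OF that, of "F j"] by simp
  ultimately show ?thesis
    by simp
qed

text \<open>
  After the substitution \<open>x = y + e\<^sub>j\<close> the hop \<open>x - e\<^sub>j + e\<^sub>k\<close> becomes \<open>y + e\<^sub>k\<close>, and the term of \<open>(j, k)\<close> becomes
  antisymmetric in \<open>j\<close> and \<open>k\<close>, so the sum over all pairs cancels.
\<close>

lemma wsum_HM_sub_symmetric:
  assumes "p \<in> poly_space n" "q \<in> poly_space n" "1 \<le> i"
  shows "wsum (\<lambda>x. q x * HM_sub n a i p x - p x * HM_sub n a i q x) = 0"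
proof -
  define S where "S = {(j, k). j \<in> {i..n} \<and> k \<in> {i..n} \<and> j \<noteq> k}"
  define G where "G = (\<lambda>(j, k) x. a k * (q x * p (x(j := x j - 1, k := x k + 1))
      - p x * q (x(j := x j - 1, k := x k + 1))))"
  define E where "E j k x = (\<beta> + (\<Sum>i = 1..n. x i)) * (q (x(j := x j + 1)) * p (x(k := x k + 1))
      - p (x(j := x j + 1)) * q (x(k := x k + 1)))" for j k x
  have "finite S"
    by (rule finite_subset[of _ "{i..n} \<times> {i..n}"]) (auto simp: S_def)
  have poly: "(\<lambda>x. x (fst s) * G s x) \<in> poly_space n" if "s \<in> S" for s
    using that assms unfolding G_def S_def by (auto intro!: poly_space_intros simp del: fun_upd_apply)
  have "wsum (\<lambda>x. x (fst s) * G s x) = (case s of (j, k) \<Rightarrow> a j * a k * wsum (E j k))" if sS: "s \<in> S" for s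
  proof -
    obtain j k where s: "s = (j, k)" "j \<in> {1..n}" "j \<noteq> k"
      using sS assms(3) by (auto simp: S_def)
    have "(x(j := x j + 1))(j := (x(j := x j + 1)) j - 1, k := (x(j := x j + 1)) k + 1) = x(k := x k + 1)"
      for x :: "nat \<Rightarrow> real"
      using s(3) by (auto simp: fun_eq_iff)
    then have "(\<lambda>x. (\<beta> + (\<Sum>i = 1..n. x i)) * a j * G s (x(j := x j + 1))) = (\<lambda>x. a j * a k * E j k x)"
      by (simp add: G_def E_def s(1) mult_ac del: fun_upd_apply)
    then show ?thesis
      using wsum_shift[OF s(2), of "G s"] by (simp add: s(1) wsum_cmult)
  qed
  then have "(\<Sum>s\<in>S. wsum (\<lambda>x. x (fst s) * G s x)) = (\<Sum>(j, k)\<in>S. a j * a k * wsum (E j k))"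
    by (rule sum.cong[OF refl])
  also have "\<dots> = 0"
  proof -
    have flip: "wsum (E k j) = - wsum (E j k)" for j k
    proof -
      have "E k j = (\<lambda>x. - 1 * E j k x)"
        by (simp add: E_def fun_eq_iff algebra_simps)
      then have "wsum (E k j) = wsum (\<lambda>x. - 1 * E j k x)"
        by (rule arg_cong)
      then show ?thesis
        using wsum_cmult[of "- 1" "E j k"] by simp
    qed
    have "(\<Sum>(j, k)\<in>S. a j * a k * wsum (E j k)) = (\<Sum>(j, k)\<in>S. a k * a j * wsum (E k j))"
      by (rule sum.reindex_bij_witness[of _ prod.swap prod.swap]) (auto simp: S_def)
    also have "\<dots> = - (\<Sum>(j, k)\<in>S. a j * a k * wsum (E j k))"
      unfolding sum_negf[symmetric]
      by (intro sum.cong refl) (clarsimp, subst flip, simp add: mult_ac)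
    finally show ?thesis by simp
  qed
  also have "(\<Sum>s\<in>S. wsum (\<lambda>x. x (fst s) * G s x)) = wsum (\<lambda>x. \<Sum>s\<in>S. x (fst s) * G s x)"
    by (rule wsum_sum[symmetric]) (use \<open>finite S\<close> poly in auto)
  also have "(\<lambda>x. \<Sum>s\<in>S. x (fst s) * G s x) = (\<lambda>x. q x * HM_sub n a i p x - p x * HM_sub n a i q x)"
  proof
    fix x
    have "q x * HM_sub n a i p x - p x * HM_sub n a i q x
      = (\<Sum>s\<in>S. p x * (case s of (j, k) \<Rightarrow> x j * a k * (q x - q (x(j := x j - 1, k := x k + 1))))
          - q x * (case s of (j, k) \<Rightarrow> x j * a k * (p x - p (x(j := x j - 1, k := x k + 1)))))"
      unfolding HM_sub_def S_def[symmetric] by (simp add: sum_subtractf flip: sum_distrib_left)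
    also have "\<dots> = (\<Sum>s\<in>S. x (fst s) * G s x)"
      by (intro sum.cong) (auto simp: G_def algebra_simps)
    finally show "(\<Sum>s\<in>S. x (fst s) * G s x) = q x * HM_sub n a i p x - p x * HM_sub n a i q x" ..
  qed
  finally show ?thesis .
qed

lemma wsum_eq_0_distinct_eigenvalues:
  assumes "wsum (\<lambda>x. q x * H p x - p x * H q x) = 0"
    and "\<And>x. H p x = c * p x" "\<And>x. H q x = d * q x" "c \<noteq> d"
  shows "wsum (\<lambda>x. p x * q x) = 0"
proof -
  have "(\<lambda>x. q x * H p x - p x * H q x) = (\<lambda>x. (c - d) * (p x * q x))"
    by (simp add: assms fun_eq_iff algebra_simps)
  then have "(c - d) * wsum (\<lambda>x. p x * q x) = 0"
    using assms(1) by (simp add: wsum_cmult)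
  then show ?thesis
    using assms(4) by simp
qed

lemma PM_poly_space: "PM n a \<beta> m \<in> poly_space n"
  unfolding poly_space_eq_Union using PM_poly_upto[OF n_pos] by blast

lemma a_nonzero: "i \<in> {1..n} \<Longrightarrow> a i \<noteq> 0"
  using a_pos by fastforce

text \<open>
  If some tail sum \<open>m\<^sub>i + \<dots> + m\<^bsub>n-1\<^esub>\<close> with \<open>i \<ge> 1\<close> differs, a suboperator separates the two eigenpolynomials;
  otherwise only \<open>m\<^sub>0\<close> differs, and \<open>HM0\<close> separates them. Admitting the empty tail
  \<open>i = n\<close> makes every \<open>m\<^sub>i\<close> with \<open>i \<ge> 1\<close> a difference of two consecutive tails.
\<close>

lemma wsum_PM_orthogonal:
  assumes "m \<in> multi_indices n" "m' \<in> multi_indices n" "m \<noteq> m'"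
  shows "wsum (\<lambda>x. PM n a \<beta> m x * PM n a \<beta> m' x) = 0"
proof -
  define tail where "tail m i = (\<Sum>j = i..n - 1. m j)" for m :: "nat \<Rightarrow> nat" and i
  show ?thesis
  proof (cases "\<exists>i \<in> {1..n}. tail m i \<noteq> tail m' i")
    case True
    then obtain i where i: "1 \<le> i" "i \<le> n" "tail m i \<noteq> tail m' i"
      by auto
    have "(\<Sum>j = i..n. a j) > 0"
      using i a_pos by (intro sum_pos) auto
    moreover have eigen: "HM_sub n a i (PM n a \<beta> k) x = - real (tail k i) * (\<Sum>j = i..n. a j) * PM n a \<beta> k x" for k x
      unfolding tail_def by (intro HM_sub_PM) (use i in \<open>auto intro!: a_nonzero\<close>)
    ultimately show ?thesis
      using i
      by (intro wsum_eq_0_distinct_eigenvalues[where H = "HM_sub n a i", OF _ eigen eigen]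
          wsum_HM_sub_symmetric PM_poly_space) auto
  next
    case False
    have "m i = m' i" if "i \<in> {1..<n}" for i
    proof -
      have "tail k i = k i + tail k (Suc i)" for k
        using that by (auto simp: tail_def sum.atLeast_Suc_atMost)
      moreover have "tail m i = tail m' i" "tail m (Suc i) = tail m' (Suc i)"
        using False that by auto
      ultimately show ?thesis
        by (metis add_right_cancel)
    qed
    moreover obtain i where "i < n" "m i \<noteq> m' i"
      using assms PiE_ext[of m "{0..<n}" "\<lambda>_. UNIV" m'] by (auto simp: multi_indices_def)
    ultimately have "m 0 \<noteq> m' 0"
      by (cases "i = 0") auto
    moreover have "tail m 1 = tail m' 1"
      using False n_pos by auto
    moreover have eigen: "HM0 n a \<beta> (PM n a \<beta> k) x
        = (real (k 0) * (1 - (\<Sum>i = 1..n. a i)) + real (tail k 1)) * PM n a \<beta> k x" for k x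
      unfolding tail_def by (rule HM0_PM) (use n_pos beta_pos a_pos in auto)
    ultimately show ?thesis
      using a_sum
      by (intro wsum_eq_0_distinct_eigenvalues[where H = "HM0 n a \<beta>", OF _ eigen eigen]
          wsum_HM0_symmetric PM_poly_space) auto
  qed
qed

lemma ip_PM_orthogonal:
  assumes "m \<in> multi_indices n" "m' \<in> multi_indices n" "m \<noteq> m'"
  shows "ip_summand n a \<beta> (PM n a \<beta> m) (PM n a \<beta> m') summable_on lattice n"
    and "ip n a \<beta> (PM n a \<beta> m) (PM n a \<beta> m') = 0"
proof -
  have eq: "ip_summand n a \<beta> (PM n a \<beta> m) (PM n a \<beta> m')
      = (\<lambda>x. (PM n a \<beta> m (\<lambda>i. real (x i)) * PM n a \<beta> m' (\<lambda>i. real (x i))) * WM n a \<beta> x)"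
    by (simp add: ip_summand_def fun_eq_iff)
  show "ip_summand n a \<beta> (PM n a \<beta> m) (PM n a \<beta> m') summable_on lattice n"
    unfolding eq by (rule wsum_summable[of "\<lambda>x. PM n a \<beta> m x * PM n a \<beta> m' x"]) (intro poly_space_intros PM_poly_space)
  show "ip n a \<beta> (PM n a \<beta> m) (PM n a \<beta> m') = 0"
    using wsum_PM_orthogonal[OF assms] by (simp add: ip_def eq wsum_def)
qed


section \<open>Completeness\<close>

text \<open>
  At \<open>(m\<^sub>1, \<dots>, m\<^bsub>n-1\<^esub>, 0)\<close> the second argument of each type two factor and the argument of the Meixner
  factor vanish, so in each of these sums a single term survives: \<open>k = m\<^sub>i\<close> and \<open>k = 0\<close>, respectively.
\<close>

lemma PM_lattice_point_nonzero:
  obtains x where "x \<in> lattice n" "PM n a \<beta> m (\<lambda>i. real (x i)) \<noteq> 0"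
proof
  define x where "x = restrict (\<lambda>i. if i < n then m i else 0) {1..n}"
  have tail: "(\<Sum>j = i..n. real (x j)) = real (\<Sum>j = i..n - 1. m j)" if "1 \<le> i" for i
  proof -
    have "(\<Sum>j = i..n. real (x j)) = (\<Sum>j = i..n - 1. real (m j))"
      by (rule sum.mono_neutral_cong_right) (use that in \<open>auto simp: x_def\<close>)
    then show ?thesis
      by simp
  qed
  show "x \<in> lattice n"
    by (simp add: x_def lattice_def)
  have a_tail: "(\<Sum>j = Suc i..n. a j) \<noteq> 0" if "i < n" for i
    using sum_pos[of "{Suc i..n}" a] a_pos that by force
  have pochhammer_0: "pochhammer 0 k = (if k = 0 then 1 else 0 :: real)" for k
    by (cases k) (auto simp: pochhammer_rec)
  have "type_two l (real l) 0 \<alpha> \<gamma> = (-1) ^ l * (\<gamma> / \<alpha>) ^ l * pochhammer (- real l) l" for l \<alpha> \<gamma>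
  proof -
    have "type_two l (real l) 0 \<alpha> \<gamma> = (\<Sum>k\<le>l. if k = l then (-1) ^ l * (\<gamma> / \<alpha>) ^ l * pochhammer (- real l) l else 0)"
      unfolding type_two_def by (rule sum.cong) (auto simp: pochhammer_0)
    then show ?thesis
      by simp
  qed
  then have two: "type_two l (real l) 0 \<alpha> \<gamma> \<noteq> 0" if "\<alpha> \<noteq> 0" "\<gamma> \<noteq> 0" for l \<alpha> \<gamma>
    using that by (simp add: pochhammer_of_nat_eq_0_iff)
  have meixner: "meixner l 0 c b = 1" for l c b
  proof -
    have "meixner l 0 c b = (\<Sum>k\<le>l. if k = 0 then 1 else 0)"
      unfolding meixner_eq_sum by (rule sum.cong) (auto simp: pochhammer_0)
    then show ?thesis
      by simp
  qed
  have "x i = m i" if "i \<in> {1..n - 1}" for i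
    using that by (auto simp: x_def)
  moreover have "type_two (m i) (real (m i)) 0 (a i) (\<Sum>j = i + 1..n. a j) \<noteq> 0" if "i \<in> {1..n - 1}" for i
  proof -
    have "i < n"
      using that by auto
    then show ?thesis
      using that a_tail[of i] by (intro two a_nonzero) auto
  qed
  ultimately show "PM n a \<beta> m (\<lambda>i. real (x i)) \<noteq> 0"
    unfolding PM_def by (simp add: tail meixner)
qed

lemma wsum_PM_square_pos: "wsum (\<lambda>x. PM n a \<beta> m x * PM n a \<beta> m x) > 0"
proof -
  define f where "f x = PM n a \<beta> m (\<lambda>i. real (x i)) * PM n a \<beta> m (\<lambda>i. real (x i)) * WM n a \<beta> x" for x
  have W: "WM n a \<beta> x > 0" for x
    unfolding WM_def using beta_pos a_pos a_sum
    by (intro mult_pos_pos divide_pos_pos pochhammer_pos prod_pos zero_less_power) auto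
  have nonneg: "f x \<ge> 0" for x
    unfolding f_def using W[of x] by (simp add: less_imp_le)
  have sum: "f summable_on lattice n"
    unfolding f_def[abs_def]
    by (rule wsum_summable[of "\<lambda>x. PM n a \<beta> m x * PM n a \<beta> m x"]) (intro poly_space_intros PM_poly_space)
  obtain x where x: "x \<in> lattice n" "PM n a \<beta> m (\<lambda>i. real (x i)) \<noteq> 0"
    by (rule PM_lattice_point_nonzero)
  then have "f x \<noteq> 0"
    using W[of x] by (simp add: f_def)
  then have "\<not> infsum f (lattice n) \<le> 0"
    using nonneg_infsum_le_0D[OF _ sum _ x(1)] nonneg by blast
  then show ?thesis
    by (simp add: wsum_def f_def[abs_def])
qed

lemma PM_eq_iff:
  assumes "m \<in> multi_indices n" "m' \<in> multi_indices n"
  shows "PM n a \<beta> m = PM n a \<beta> m' \<longleftrightarrow> m = m'"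
proof
  assume eq: "PM n a \<beta> m = PM n a \<beta> m'"
  show "m = m'"
  proof (rule ccontr)
    assume "m \<noteq> m'"
    then show False
      using wsum_PM_orthogonal[OF assms] wsum_PM_square_pos[of m] by (simp flip: eq)
  qed
qed simp

lemma inj_on_PM: "inj_on (PM n a \<beta>) (multi_indices n)"
  by (rule inj_onI) (simp add: PM_eq_iff)

text \<open>
  Pair a vanishing linear combination with one of its members: orthogonality leaves only the
  coefficient of that member, times its positive norm.
\<close>

lemma independent_PM: "independent (PM n a \<beta> ` multi_indices n)"
proof -
  have coefficient: "u v = 0"
    if t: "finite t" "t \<subseteq> PM n a \<beta> ` multi_indices n" "(\<Sum>w\<in>t. u w *\<^sub>R w) = 0" "v \<in> t"
    for t v and u :: "((nat \<Rightarrow> real) \<Rightarrow> real) \<Rightarrow> real"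
  proof -
    have poly: "w \<in> poly_space n" if "w \<in> t" for w
      using that t(2) PM_poly_space by auto
    have "(\<Sum>w\<in>t. u w *\<^sub>R w) x = (\<Sum>w\<in>t. u w * w x)" for x
      using t(1) by (induction t rule: finite_induct) (auto simp: scaleR_fun_def plus_fun_def zero_fun_def)
    then have "(\<Sum>w\<in>t. u w * (w x * v x)) = 0" for x
      using t(3) by (simp add: zero_fun_def mult.assoc[symmetric] flip: sum_distrib_right)
    then have "0 = wsum (\<lambda>x. \<Sum>w\<in>t. u w * (w x * v x))"
      by (simp add: wsum_def)
    also have "\<dots> = (\<Sum>w\<in>t. wsum (\<lambda>x. u w * (w x * v x)))"
      by (rule wsum_sum) (use t poly in \<open>auto intro!: poly_space_intros\<close>)
    also have "\<dots> = (\<Sum>w\<in>t. if w = v then u v * wsum (\<lambda>x. v x * v x) else 0)"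
    proof (rule sum.cong)
      fix w assume "w \<in> t"
      then obtain m m' where m: "m \<in> multi_indices n" "w = PM n a \<beta> m"
          "m' \<in> multi_indices n" "v = PM n a \<beta> m'"
        using t(2,4) by blast
      then show "wsum (\<lambda>x. u w * (w x * v x)) = (if w = v then u v * wsum (\<lambda>x. v x * v x) else 0)"
        using wsum_PM_orthogonal[of m m'] by (auto simp: wsum_cmult)
    qed simp
    also have "\<dots> = u v * wsum (\<lambda>x. v x * v x)"
      using t(1,4) by simp
    finally have "u v * wsum (\<lambda>x. v x * v x) = 0"
      by simp
    moreover have "wsum (\<lambda>x. v x * v x) \<noteq> 0"
    proof -
      obtain m where v: "v = PM n a \<beta> m"
        using t(2,4) by blast
      show ?thesis
        unfolding v using wsum_PM_square_pos[of m] by (rule less_imp_neq[symmetric])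
    qed
    ultimately show ?thesis
      by (simp only: mult_eq_0_iff simp_thms)
  qed
  show ?thesis
    unfolding real_vector.independent_explicit_module using coefficient by blast
qed

text \<open>
  The monomials of degree at most \<open>d\<close> are at most as many as the independent eigenpolynomials inside their
  span. A monomial outside the span of those eigenpolynomials would enlarge them to an independent family with
  too many members.
\<close>

lemma poly_upto_subset_span_PM:
  "poly_upto n d \<subseteq> span (PM n a \<beta> ` {m \<in> multi_indices n. (\<Sum>j = 0..n - 1. m j) \<le> d})"
proof -
  define I where "I = {m \<in> multi_indices n. (\<Sum>j = 0..n - 1. m j) \<le> d}"
  define T where "T = monom_fun n ` {k. (\<Sum>i = 1..n. k i) \<le> d}"
  have poly_upto: "poly_upto n d = span T"
    by (simp add: poly_upto_def T_def)
  have "m \<in> {0..<n} \<rightarrow>\<^sub>E {0..d}" if "m \<in> I" for m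
  proof -
    have "m i \<le> d" if "i < n" for i
    proof -
      have "m i \<le> (\<Sum>j = 0..n - 1. m j)"
        using \<open>i < n\<close> by (intro member_le_sum) auto
      then show ?thesis
        using \<open>m \<in> I\<close> by (simp add: I_def)
    qed
    then show ?thesis
      using that by (auto simp: I_def multi_indices_def PiE_iff)
  qed
  then have "finite I"
    by (intro finite_subset[of I "{0..<n} \<rightarrow>\<^sub>E {0..d}"] finite_PiE) auto
  \<comment> \<open>Multi-indices on \<open>0, \<dots>, n - 1\<close> and exponents on \<open>1, \<dots>, n\<close> correspond by a shift of the index.\<close>
  have "T \<subseteq> (\<lambda>m. monom_fun n (\<lambda>i. m (i - 1))) ` I"
  proof
    fix f assume "f \<in> T"
    then obtain k where k: "f = monom_fun n k" "(\<Sum>i = 1..n. k i) \<le> d"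
      by (auto simp: T_def)
    define m where "m = restrict (\<lambda>i. k (Suc i)) {0..<n}"
    have "(\<Sum>j = 0..n - 1. m j) = (\<Sum>i = 1..n. k i)"
    proof -
      have "(\<Sum>j = 0..n - 1. m j) = (\<Sum>j = 0..n - 1. k (Suc j))"
        using n_pos by (intro sum.cong refl) (auto simp: m_def)
      then show ?thesis
        using n_pos sum.shift_bounds_cl_Suc_ivl[of k 0 "n - 1"] by simp
    qed
    moreover have "m \<in> multi_indices n"
      unfolding m_def multi_indices_def by (rule restrict_PiE_iff[THEN iffD2]) simp
    ultimately have "m \<in> I"
      using k(2) by (simp add: I_def)
    moreover have "f = monom_fun n (\<lambda>i. m (i - 1))"
    proof -
      have m_pred: "m (i - 1) = k i" if "i \<in> {1..n}" for i
      proof -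
        have "i - 1 \<in> {0..<n}" "Suc (i - 1) = i"
          using that by auto
        then show ?thesis
          unfolding m_def by (simp only: restrict_apply' if_True)
      qed
      show ?thesis
        unfolding k(1) by (rule ext, unfold monom_fun_def, rule prod.cong) (simp_all only: m_pred)
    qed
    ultimately show "f \<in> (\<lambda>m. monom_fun n (\<lambda>i. m (i - 1))) ` I"
      by blast
  qed
  then have T: "finite T" "card T \<le> card I"
    using \<open>finite I\<close> by (auto intro: finite_subset surj_card_le)
  have "inj_on (PM n a \<beta>) I"
    using inj_on_PM by (rule inj_on_subset) (auto simp: I_def)
  then have card: "card (PM n a \<beta> ` I) = card I"
    by (rule card_image)
  have indep: "independent (PM n a \<beta> ` I)"
    using independent_PM by (rule independent_mono) (auto simp: I_def)
  have sub: "PM n a \<beta> ` I \<subseteq> span T"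
    unfolding poly_upto[symmetric]
  proof (rule image_subsetI)
    fix m assume "m \<in> I"
    then have "(\<Sum>j = 0..n - 1. m j) \<le> d"
      unfolding I_def by blast
    then show "PM n a \<beta> m \<in> poly_upto n d"
      using PM_poly_upto[OF n_pos] by (rule poly_upto_mono)
  qed
  have "T \<subseteq> span (PM n a \<beta> ` I)"
  proof (rule ccontr)
    assume "\<not> ?thesis"
    then obtain f where f: "f \<in> T" "f \<notin> span (PM n a \<beta> ` I)"
      by blast
    from f(2) indep have "independent (insert f (PM n a \<beta> ` I))"
      by (rule independent_insertI)
    moreover have "insert f (PM n a \<beta> ` I) \<subseteq> span T"
      using sub span_base[OF f(1)] by (rule insert_subsetI[rotated])
    ultimately have "card (insert f (PM n a \<beta> ` I)) \<le> card T"
      using independent_span_bound[OF T(1)] by blast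
    moreover have "f \<notin> PM n a \<beta> ` I"
      using f(2) span_base[of f "PM n a \<beta> ` I"] by argo
    ultimately show False
      using \<open>finite I\<close> T(2) card by simp
  qed
  then have "span T \<subseteq> span (PM n a \<beta> ` I)"
    using subspace_span by (rule span_minimal)
  then show ?thesis
    unfolding poly_upto I_def .
qed

lemma span_PM: "span (PM n a \<beta> ` multi_indices n) = poly_space n"
proof
  have "subspace (poly_space n)"
    unfolding poly_space_def by (rule subspace_span)
  with image_subsetI[OF PM_poly_space]
  show "span (PM n a \<beta> ` multi_indices n) \<subseteq> poly_space n"
    by (rule span_minimal)
  show "poly_space n \<subseteq> span (PM n a \<beta> ` multi_indices n)"
    unfolding poly_space_eq_Union
  proof (rule UN_least)
    fix d
    have "PM n a \<beta> ` {m \<in> multi_indices n. (\<Sum>j = 0..n - 1. m j) \<le> d} \<subseteq> PM n a \<beta> ` multi_indices n"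
      by (intro image_mono) auto
    then show "poly_upto n d \<subseteq> span (PM n a \<beta> ` multi_indices n)"
      using poly_upto_subset_span_PM by (meson order_trans span_mono)
  qed
qed

end

theorem theorem6p1:
  fixes n :: nat and \<beta> :: real and a :: "nat \<Rightarrow> real"
  assumes "n \<ge> 2" and "\<beta> > 0"
    and "\<And>i. i \<in> {1..n} \<Longrightarrow> a i > 0" and "(\<Sum>i = 1..n. a i) < 1"
  shows
    "(\<forall>m \<in> multi_indices n. \<forall>x. PM n a \<beta> m x =
        (\<Prod>i = 1..n - 1. \<Sum>k\<le>m i.
            (-1) ^ k * real (m i choose k) * ((\<Sum>j = i + 1..n. a j) / a i) ^ k
            * pochhammer (- x i) k
            * pochhammer (- (\<Sum>j = i + 1..n. x j) + real (\<Sum>j = i + 1..n - 1. m j)) (m i - k))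
        * hyp2F1 (- real (m 0)) (- (\<Sum>i = 1..n. x i) + real (\<Sum>j = 1..n - 1. m j))
            (\<beta> + real (\<Sum>j = 1..n - 1. m j))
            (((\<Sum>i = 1..n. a i) - 1) / (\<Sum>i = 1..n. a i)))
    \<and> inj_on (PM n a \<beta>) (multi_indices n)
    \<and> independent (PM n a \<beta> ` multi_indices n)
    \<and> span (PM n a \<beta> ` multi_indices n) = poly_space n
    \<and> (\<forall>m \<in> multi_indices n. \<forall>x.
        HMT n a \<beta> (PM n a \<beta> m) x
          = real (\<Sum>j = 0..n - 1. m j) * (1 - (\<Sum>i = 1..n. a i)) * PM n a \<beta> m x)
    \<and> (\<forall>m \<in> multi_indices n. \<forall>i \<in> {1..n - 1}. \<forall>x.
        HM_sub n a i (PM n a \<beta> m) x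
          = - real (\<Sum>j = i..n - 1. m j) * (\<Sum>j = i..n. a j) * PM n a \<beta> m x)
    \<and> (\<forall>m \<in> multi_indices n. \<forall>m' \<in> multi_indices n. m \<noteq> m' \<longrightarrow>
        ip_summand n a \<beta> (PM n a \<beta> m) (PM n a \<beta> m') summable_on lattice n
        \<and> ip n a \<beta> (PM n a \<beta> m) (PM n a \<beta> m') = 0)"
proof -
  interpret meixner_system n \<beta> a
    by standard (use assms in auto)
  define c where "c = (\<Sum>i = 1..n. a i)"
  have "c > 0"
    unfolding c_def using n_pos a_pos by (intro sum_pos) auto
  then have z: "1 - inverse c = (c - 1) / c"
    by (simp add: field_simps)
  have explicit: "PM n a \<beta> m x =
        (\<Prod>i = 1..n - 1. \<Sum>k\<le>m i.
            (-1) ^ k * real (m i choose k) * ((\<Sum>j = i + 1..n. a j) / a i) ^ k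
            * pochhammer (- x i) k
            * pochhammer (- (\<Sum>j = i + 1..n. x j) + real (\<Sum>j = i + 1..n - 1. m j)) (m i - k))
        * hyp2F1 (- real (m 0)) (- (\<Sum>i = 1..n. x i) + real (\<Sum>j = 1..n - 1. m j))
            (\<beta> + real (\<Sum>j = 1..n - 1. m j))
            (((\<Sum>i = 1..n. a i) - 1) / (\<Sum>i = 1..n. a i))" for m x
    unfolding PM_def type_two_def meixner_def c_def[symmetric] z by simp
  have sub: "HM_sub n a i (PM n a \<beta> m) x
      = - real (\<Sum>j = i..n - 1. m j) * (\<Sum>j = i..n. a j) * PM n a \<beta> m x"
    if "i \<in> {1..n - 1}" for m i x
    by (rule HM_sub_PM) (use that in \<open>auto intro!: a_nonzero\<close>)
  have total: "HMT n a \<beta> (PM n a \<beta> m) x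
      = real (\<Sum>j = 0..n - 1. m j) * (1 - (\<Sum>i = 1..n. a i)) * PM n a \<beta> m x" for m x
    by (rule HMT_PM) (use n_pos beta_pos a_pos in auto)
  show ?thesis
    by (intro conjI ballI allI impI explicit inj_on_PM independent_PM span_PM total sub ip_PM_orthogonal)
qed

end
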